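(* Let $G$ be a graph of order $n$ with no isolated vertices, where $n\ge 6$. (i) If $n=6$ and $q(G)\ge q(K_1\vee (K_4\cup K_1))$, then $G$ contains a trebly chorded cycle with three chords incident to a vertex, unless $G\cong K_1\vee (K_4\cup K_1)$. (ii) If $n\ge 7$ and $q(G)\ge q(K_{1,1,n-2}^+)$, then $G$ contains a trebly chorded cycle with three chords incident to a vertex, unless $G\cong K_{1,1,n-2}^+$.
   Context: All graphs are finite and simple. For a graph $G$, $Q(G)=D(G)+A(G)$ is the signless Laplacian matrix, where $A(G)$ is the adjacency matrix and $D(G)$ the diagonal matrix of vertex degrees; $q(G)$ denotes the largest eigenvalue of $Q(G)$ (the signless Laplacian index). A chord of a cycle $C$ is an edge joining two non-consecutive vertices of $C$. "$G$ contains a trebly chorded cycle with three chords incident to a vertex" means that $G$ has a cycle $C$ and three distinct edges of $G$, each a chord of $C$, all sharing a common endpoint. $K_m$ is the complete graph on $m$ vertices; $G\cup H$ is the disjoint union and $G\vee H$ the join (disjoint union plus all edges between $V(G)$ and $V(H)$). $K_{1,1,n-2}$ is the complete tripartite graph with parts of sizes $1,1,n-2$, and $K_{1,1,n-2}^+$ is obtained from it by adding one edge inside the part of size $n-2$. *)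

theory Defs
  imports "Jordan_Normal_Form.Char_Poly"
begin

definition simple_graph :: "nat \<Rightarrow> nat set set \<Rightarrow> bool" where
  "simple_graph n E \<longleftrightarrow> (\<forall>e\<in>E. \<exists>u v. e = {u, v} \<and> u \<noteq> v \<and> u < n \<and> v < n)"

definition no_isolated :: "nat \<Rightarrow> nat set set \<Rightarrow> bool" where
  "no_isolated n E \<longleftrightarrow> (\<forall>v<n. \<exists>e\<in>E. v \<in> e)"

definition degree :: "nat set set \<Rightarrow> nat \<Rightarrow> nat" where
  "degree E v = card {e\<in>E. v \<in> e}"

definition signless_laplacian :: "nat \<Rightarrow> nat set set \<Rightarrow> real mat" where
  "signless_laplacian n E = mat n n (\<lambda>(i, j).
     (if i = j then real (degree E i) else 0) + (if {i, j} \<in> E then 1 else 0))"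

definition q_index :: "nat \<Rightarrow> nat set set \<Rightarrow> real" where
  "q_index n E = Max {k. eigenvalue (signless_laplacian n E) k}"

definition graph_iso :: "nat \<Rightarrow> nat set set \<Rightarrow> nat set set \<Rightarrow> bool" where
  "graph_iso n E E' \<longleftrightarrow> (\<exists>f. bij_betw f {0..<n} {0..<n} \<and>
      (\<forall>u<n. \<forall>v<n. {u, v} \<in> E \<longleftrightarrow> {f u, f v} \<in> E'))"

definition is_cycle :: "nat set set \<Rightarrow> nat list \<Rightarrow> bool" where
  "is_cycle E cs \<longleftrightarrow> distinct cs \<and> length cs \<ge> 3 \<and>
     (\<forall>i<length cs. {cs ! i, cs ! ((i + 1) mod length cs)} \<in> E)"

definition cycle_consecutive :: "nat list \<Rightarrow> nat \<Rightarrow> nat \<Rightarrow> bool" where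
  "cycle_consecutive cs x y \<longleftrightarrow>
     (\<exists>i<length cs. {cs ! i, cs ! ((i + 1) mod length cs)} = {x, y})"

definition is_chord :: "nat set set \<Rightarrow> nat list \<Rightarrow> nat set \<Rightarrow> bool" where
  "is_chord E cs e \<longleftrightarrow> e \<in> E \<and>
     (\<exists>x y. e = {x, y} \<and> x \<noteq> y \<and> x \<in> set cs \<and> y \<in> set cs \<and> \<not> cycle_consecutive cs x y)"

definition has_trebly_chorded_cycle_at_vertex :: "nat set set \<Rightarrow> bool" where
  "has_trebly_chorded_cycle_at_vertex E \<longleftrightarrow>
     (\<exists>cs w e1 e2 e3. is_cycle E cs \<and> is_chord E cs e1 \<and> is_chord E cs e2 \<and> is_chord E cs e3 \<and>
        e1 \<noteq> e2 \<and> e1 \<noteq> e3 \<and> e2 \<noteq> e3 \<and> w \<in> e1 \<and> w \<in> e2 \<and> w \<in> e3)"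

text \<open>K_1 join (K_4 union K_1) on {0..<6}: vertex 0 is the K_1 of the join, {1,2,3,4} the K_4,
  vertex 5 the isolated K_1.\<close>
definition K1_join_K4_K1 :: "nat set set" where
  "K1_join_K4_K1 = {{u, v} | u v. u \<noteq> v \<and> u < 6 \<and> v < 6 \<and>
      (u = 0 \<or> v = 0 \<or> (1 \<le> u \<and> u \<le> 4 \<and> 1 \<le> v \<and> v \<le> 4))}"

text \<open>K_{1,1,n-2}^+ on {0..<n}: parts {0}, {1}, {2..<n}, plus the edge {2,3}.\<close>
definition K112_plus :: "nat \<Rightarrow> nat set set" where
  "K112_plus n = {{u, v} | u v. u \<noteq> v \<and> u < n \<and> v < n \<and>
      (u \<le> 1 \<or> v \<le> 1 \<or> {u, v} = {2, 3})}"

end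

theory Submission
  imports Defs "Jordan_Normal_Form.Spectral_Radius"
begin

text \<open>Suppose \<open>G\<close> has no such cycle. The absolute values \<open>y\<^sub>u\<close> of the entries of an eigenvector of the
  index \<open>q\<close> satisfy \<open>q y\<^sub>u \<le> d\<^sub>u y\<^sub>u + \<Sum>\<^sub>w y\<^sub>w\<close> (sum over the neighbours \<open>w\<close> of \<open>u\<close>). Let \<open>v\<close> maximise
  \<open>y\<^sub>u / (d\<^sub>u - \<alpha>)\<close> with a small shift \<open>\<alpha>\<close>, and let \<open>S\<close> be the neighbourhood of \<open>v\<close>. For \<open>n \<ge> 7\<close> the
  inequality at \<open>v\<close> gives \<open>2 e(S) \<ge> 2 |S| - 2 + m\<close>, where \<open>m\<close> counts the non-adjacent pairs between \<open>S\<close>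
  and the non-neighbours of \<open>v\<close>. On the other hand \<open>G[S]\<close> contains no path on five vertices, so apart
  from copies of \<open>K\<^sub>4\<close> and \<open>K\<^sub>4 - e\<close> it has at most \<open>|S|\<close> edges, and almost every way to attach a
  non-neighbour of \<open>v\<close> to \<open>S\<close> creates a cycle with three chords at one vertex; the copies of \<open>K\<^sub>4\<close> and
  \<open>K\<^sub>4 - e\<close> consist of low-degree vertices, on which \<open>y\<close> is much smaller than the degree. Hence \<open>v\<close>
  dominates \<open>G\<close> and no such copy exists. Applying the inequality once more yields
  \<open>\<Sum> g (g + 1) \<ge> |S| (|S| + 1)\<close> for the degrees \<open>g\<close> in \<open>G[S]\<close>, which forces a second dominating vertex
  and exactly one further edge. For \<open>n = 6\<close> the count alone suffices.\<close>

section \<open>Edge counts\<close>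

lemma card_ge_2E:
  assumes "2 \<le> card A"
  obtains a b where "a \<in> A" "b \<in> A" "a \<noteq> b"
proof -
  obtain B where "B \<subseteq> A" "card B = 2" using assms by (metis obtain_subset_with_card_n)
  thus ?thesis using that by (auto simp: card_2_iff)
qed

lemma card_ge_3E:
  assumes "3 \<le> card A"
  obtains a b c where "a \<in> A" "b \<in> A" "c \<in> A" "a \<noteq> b" "a \<noteq> c" "b \<noteq> c"
proof -
  obtain B where "B \<subseteq> A" "card B = 3" using assms by (metis obtain_subset_with_card_n)
  thus ?thesis using that by (auto simp: card_3_iff)
qed

locale adjacency =
  fixes adj :: "'a \<Rightarrow> 'a \<Rightarrow> bool"
  assumes adj_commute: "adj u w \<longleftrightarrow> adj w u"
    and adj_irrefl [simp]: "\<not> adj u u"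
begin

definition N :: "'a \<Rightarrow> 'a set" where
  "N u = {w. adj u w}"

abbreviation deg_in :: "'a set \<Rightarrow> 'a \<Rightarrow> nat" where
  "deg_in W s \<equiv> card (N s \<inter> W)"

text \<open>Counts ordered pairs, so \<open>edge_count W W\<close> is twice the number of edges inside \<open>W\<close>.\<close>
definition edge_count :: "'a set \<Rightarrow> 'a set \<Rightarrow> nat" where
  "edge_count A B = (\<Sum>s\<in>A. deg_in B s)"

lemma in_N [simp]: "w \<in> N u \<longleftrightarrow> adj u w"
  by (simp add: N_def)

lemma edge_count_empty [simp]: "edge_count {} B = 0"
  by (simp add: edge_count_def)

lemma edge_count_singleton [simp]: "edge_count {s} B = deg_in B s"
  by (simp add: edge_count_def)

lemma sum_over_neighbours:
  fixes f :: "'a \<Rightarrow> 'b::semiring_1"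
  assumes "finite A" "finite B"
  shows "(\<Sum>s\<in>A. \<Sum>w\<in>N s \<inter> B. f w) = (\<Sum>w\<in>B. of_nat (deg_in A w) * f w)"
proof -
  have inner: "(\<Sum>w\<in>N s \<inter> V. g w) = (\<Sum>w\<in>V. if adj s w then g w else 0)"
    if "finite V" for s V and g :: "'a \<Rightarrow> 'b"
    using sum.inter_restrict[OF that, of g "N s"] by (simp add: Int_commute)
  have "(\<Sum>s\<in>A. \<Sum>w\<in>N s \<inter> B. f w) = (\<Sum>w\<in>B. \<Sum>s\<in>A. if adj s w then f w else 0)"
    unfolding inner[OF assms(2)] by (rule sum.swap)
  also have "\<dots> = (\<Sum>w\<in>B. \<Sum>s\<in>N w \<inter> A. f w)"
    unfolding inner[OF assms(1)] by (simp add: adj_commute)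
  finally show ?thesis by simp
qed

lemma edge_count_commute:
  assumes "finite A" "finite B"
  shows "edge_count A B = edge_count B A"
  using sum_over_neighbours[OF assms, of "\<lambda>_. 1 :: nat"] by (simp add: edge_count_def)

lemma edge_count_Un_left:
  assumes "finite A" "finite A'" "A \<inter> A' = {}"
  shows "edge_count (A \<union> A') B = edge_count A B + edge_count A' B"
  using assms by (simp add: edge_count_def sum.union_disjoint)

lemma edge_count_Un_right:
  assumes "finite B" "finite B'" "B \<inter> B' = {}"
  shows "edge_count A (B \<union> B') = edge_count A B + edge_count A B'"
proof -
  have "deg_in (B \<union> B') s = deg_in B s + deg_in B' s" for s
    using assms by (simp add: Int_Un_distrib card_Un_disjoint disjoint_iff)
  thus ?thesis by (simp add: edge_count_def sum.distrib)
qed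

lemma edge_count_le:
  assumes "\<And>s. s \<in> A \<Longrightarrow> deg_in B s \<le> k"
  shows "edge_count A B \<le> card A * k"
  using sum_bounded_above[of A "deg_in B" k] assms by (simp add: edge_count_def)

lemma deg_in_less_card:
  assumes "finite W" "s \<in> W"
  shows "deg_in W s < card W"
proof (rule psubset_card_mono)
  have "s \<notin> N s" by simp
  thus "N s \<inter> W \<subset> W" using assms(2) by blast
qed (use assms in auto)

lemma edge_count_le_complete:
  assumes "finite W"
  shows "edge_count W W \<le> card W * (card W - 1)"
  using deg_in_less_card[OF assms] by (intro edge_count_le) fastforce

lemma edge_count_insert:
  assumes "finite V" "p \<notin> V"
  shows "edge_count (insert p V) (insert p V) = edge_count V V + 2 * deg_in V p"
proof -
  have "edge_count (insert p V) (insert p V) = deg_in (insert p V) p + edge_count V (insert p V)"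
    using assms edge_count_Un_left[of "{p}" V "insert p V"] by simp
  also have "edge_count V (insert p V) = edge_count V {p} + edge_count V V"
    using assms edge_count_Un_right[of "{p}" V V] by simp
  also have "edge_count V {p} = deg_in V p"
    using assms edge_count_commute[of V "{p}"] by simp
  also have "N p \<inter> insert p V = N p \<inter> V" by auto
  finally show ?thesis by simp
qed

text \<open>Deleting a vertex of degree at most 1 does not decrease \<open>edge_count W W - 2 * card W\<close>,
  which is at least \<open>- 1\<close> initially but \<open>- 2\<close> for a single vertex.\<close>
lemma min_degree_2_core:
  assumes "finite W" "W \<noteq> {}" "2 * card W \<le> edge_count W W + 1"
  obtains W' where "W' \<subseteq> W" "W' \<noteq> {}" "\<forall>s\<in>W'. 2 \<le> deg_in W' s"
    "edge_count W W + 2 * card W' \<le> edge_count W' W' + 2 * card W"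
  using assms
proof (induction W arbitrary: thesis rule: finite_psubset_induct)
  case (psubset W)
  show ?case
  proof (cases "\<forall>s\<in>W. 2 \<le> deg_in W s")
    case True
    thus ?thesis using psubset.prems by blast
  next
    case False
    then obtain p where p: "p \<in> W" "deg_in W p \<le> 1" by force
    define V where "V = W - {p}"
    have W: "W = insert p V" and V: "p \<notin> V" "finite V" "V \<subset> W"
      using p(1) psubset.hyps by (auto simp: V_def)
    have "N p \<inter> W = N p \<inter> V" by (auto simp: V_def)
    hence loss: "edge_count W W \<le> edge_count V V + 2"
      using edge_count_insert[OF V(2,1)] p(2) by (simp flip: W)
    have card: "card W = card V + 1" using V(1,2) by (simp add: W)
    have "V \<noteq> {}"
    proof
      assume "V = {}"
      hence "edge_count W W = 0" by (simp add: W edge_count_def)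
      thus False using psubset.prems(3) card by simp
    qed
    moreover have "2 * card V \<le> edge_count V V + 1" using psubset.prems(3) loss card by simp
    ultimately obtain W' where "W' \<subseteq> V" "W' \<noteq> {}" "\<forall>s\<in>W'. 2 \<le> deg_in W' s"
      "edge_count V V + 2 * card W' \<le> edge_count W' W' + 2 * card V"
      using psubset.IH[OF V(3)] by blast
    thus ?thesis using psubset.prems(1)[of W'] loss card V(3) by auto
  qed
qed

lemma second_neighbour:
  assumes "2 \<le> deg_in W s"
  obtains u where "u \<in> W" "adj s u" "u \<noteq> w"
proof -
  obtain a b where "a \<in> N s \<inter> W" "b \<in> N s \<inter> W" "a \<noteq> b" using card_ge_2E[OF assms] .
  thus ?thesis using that by (cases "a = w") auto
qed

text \<open>The closed subsets are the unions of connected components of the subgraph induced by \<open>W\<close>.\<close>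
definition closed_in :: "'a set \<Rightarrow> 'a set \<Rightarrow> bool" where
  "closed_in W R \<longleftrightarrow> R \<subseteq> W \<and> (\<forall>s\<in>R. \<forall>u\<in>W. adj s u \<longrightarrow> u \<in> R)"

lemma closed_inI: "R \<subseteq> W \<Longrightarrow> (\<And>s u. s \<in> R \<Longrightarrow> u \<in> W \<Longrightarrow> adj s u \<Longrightarrow> u \<in> R) \<Longrightarrow> closed_in W R"
  by (auto simp: closed_in_def)

lemma closed_inD: "closed_in W R \<Longrightarrow> s \<in> R \<Longrightarrow> u \<in> W \<Longrightarrow> adj s u \<Longrightarrow> u \<in> R"
  by (auto simp: closed_in_def)

lemma closed_in_subset: "closed_in W R \<Longrightarrow> R \<subseteq> W"
  by (simp add: closed_in_def)

lemma closed_in_refl: "closed_in W W"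
  by (simp add: closed_in_def)

lemma closed_in_Diff: "closed_in W R \<Longrightarrow> closed_in W R' \<Longrightarrow> closed_in W (R - R')"
  unfolding closed_in_def by (metis (no_types, lifting) Diff_iff adj_commute subset_iff)

lemma closed_in_N_Int: "closed_in W R \<Longrightarrow> s \<in> R \<Longrightarrow> N s \<inter> W = N s \<inter> R"
  unfolding closed_in_def by auto

lemma closed_in_edge_count: "closed_in W R \<Longrightarrow> edge_count R W = edge_count R R"
  unfolding edge_count_def by (intro sum.cong) (simp_all add: closed_in_N_Int)

lemma edge_count_closed_split:
  assumes "finite W" "closed_in W R"
  shows "edge_count W W = edge_count R R + edge_count (W - R) (W - R)"
proof -
  have "edge_count W W = edge_count R W + edge_count (W - R) W"
    using assms edge_count_Un_left[of R "W - R" W] finite_subset[OF closed_in_subset]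
    by (simp add: Un_absorb1 closed_in_subset)
  thus ?thesis
    using assms(2) closed_in_Diff[OF closed_in_refl assms(2)] by (simp add: closed_in_edge_count)
qed

lemma closed_in_card_Diff:
  assumes "finite W" "closed_in W R"
  shows "card W = card R + card (W - R)"
  using assms card_Un_disjoint[of R "W - R"] finite_subset[OF closed_in_subset]
  by (simp add: Un_absorb1 closed_in_subset)

end

section \<open>Graphs without a path on five vertices\<close>

context adjacency
begin

definition path5_free :: "'a set \<Rightarrow> bool" where
  "path5_free W \<longleftrightarrow> (\<forall>a b c d e. {a, b, c, d, e} \<subseteq> W \<and> distinct [a, b, c, d, e] \<and>
     adj a b \<and> adj b c \<and> adj c d \<longrightarrow> \<not> adj d e)"

definition clique :: "'a set \<Rightarrow> bool" where
  "clique Q \<longleftrightarrow> (\<forall>p\<in>Q. \<forall>q\<in>Q. p \<noteq> q \<longrightarrow> adj p q)"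

definition four_cycle :: "'a \<Rightarrow> 'a \<Rightarrow> 'a \<Rightarrow> 'a \<Rightarrow> bool" where
  "four_cycle p q r s \<longleftrightarrow> distinct [p, q, r, s] \<and> adj p q \<and> adj q r \<and> adj r s \<and> adj s p"

definition spans_four_cycle :: "'a set \<Rightarrow> bool" where
  "spans_four_cycle Q \<longleftrightarrow> (\<exists>p q r s. Q = {p, q, r, s} \<and> four_cycle p q r s)"

text \<open>Not necessarily induced, so a copy of \<open>K\<^sub>4\<close> is a diamond as well.\<close>
definition diamond :: "'a set \<Rightarrow> bool" where
  "diamond Q \<longleftrightarrow> (\<exists>p q r s. Q = {p, q, r, s} \<and> four_cycle p q r s \<and> adj p r)"

definition diamond_free :: "'a set \<Rightarrow> bool" where
  "diamond_free W \<longleftrightarrow> (\<forall>Q\<subseteq>W. \<not> diamond Q)"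

definition diamonds :: "'a set \<Rightarrow> 'a set" where
  "diamonds W = \<Union>{Q. Q \<subseteq> W \<and> diamond Q}"

lemma diamondI: "four_cycle p q r s \<Longrightarrow> adj p r \<Longrightarrow> diamond {p, q, r, s}"
  unfolding diamond_def by blast

lemma cliqueD: "clique Q \<Longrightarrow> p \<in> Q \<Longrightarrow> q \<in> Q \<Longrightarrow> p \<noteq> q \<Longrightarrow> adj p q"
  unfolding clique_def by blast

lemma path5_freeD:
  assumes "path5_free W" "{a, b, c, d, e} \<subseteq> W" "distinct [a, b, c, d, e]"
    and "adj a b" "adj b c" "adj c d" "adj d e"
  shows False
  using assms unfolding path5_free_def by blast

lemma diamond_freeD: "diamond_free W \<Longrightarrow> Q \<subseteq> W \<Longrightarrow> \<not> diamond Q"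
  unfolding diamond_free_def by blast

lemma not_diamond_freeE:
  assumes "\<not> diamond_free W"
  obtains Q where "diamond Q" "Q \<subseteq> W"
  using assms unfolding diamond_free_def by blast

lemma path5_free_subset: "path5_free W \<Longrightarrow> V \<subseteq> W \<Longrightarrow> path5_free V"
  unfolding path5_free_def by (meson order_trans)

lemma diamond_free_subset: "diamond_free W \<Longrightarrow> V \<subseteq> W \<Longrightarrow> diamond_free V"
  unfolding diamond_free_def by blast

lemma four_cycle_from:
  assumes "spans_four_cycle Q" "p \<in> Q"
  obtains q r s where "Q = {p, q, r, s}" "four_cycle p q r s"
proof -
  obtain a b c d where Q: "Q = {a, b, c, d}" and cycle: "four_cycle a b c d"
    using assms(1) unfolding spans_four_cycle_def by blast
  have rotations: "four_cycle b c d a" "four_cycle c d a b" "four_cycle d a b c"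
    using cycle by (auto simp: four_cycle_def)
  have "Q = {b, c, d, a}" "Q = {c, d, a, b}" "Q = {d, a, b, c}" using Q by auto
  thus ?thesis using that cycle rotations Q assms(2) by blast
qed

lemma spans_four_cycle_card: "spans_four_cycle Q \<Longrightarrow> card Q = 4"
  by (auto simp: spans_four_cycle_def four_cycle_def)

lemma spans_four_cycle_finite: "spans_four_cycle Q \<Longrightarrow> finite Q"
  by (auto simp: spans_four_cycle_def)

lemma spans_four_cycle_closed:
  assumes "path5_free W" "spans_four_cycle Q" "Q \<subseteq> W"
  shows "closed_in W Q"
proof (rule closed_inI[OF assms(3)], rule ccontr)
  fix p u assume u: "p \<in> Q" "u \<in> W" "adj p u" "u \<notin> Q"
  obtain q r s where "Q = {p, q, r, s}" "four_cycle p q r s"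
    using four_cycle_from[OF assms(2) u(1)] .
  thus False
    using path5_freeD[OF assms(1), of u p q r s] u assms(3)
    by (auto simp: four_cycle_def adj_commute)
qed

lemma diamond_spans_four_cycle: "diamond Q \<Longrightarrow> spans_four_cycle Q"
  by (auto simp: diamond_def spans_four_cycle_def)

lemmas diamond_card = spans_four_cycle_card[OF diamond_spans_four_cycle]
  and diamond_finite = spans_four_cycle_finite[OF diamond_spans_four_cycle]
  and diamond_closed = spans_four_cycle_closed[OF _ diamond_spans_four_cycle]

lemma diamond_edge_count_le:
  assumes "diamond Q"
  shows "edge_count Q Q \<le> 12"
  using edge_count_le[of Q Q 3] deg_in_less_card[of Q] diamond_card[OF assms] diamond_finite[OF assms]
  by (simp add: numeral_eq_Suc less_Suc_eq_le)

lemma diamond_edge_count_nonclique: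
  assumes "diamond Q" "\<not> clique Q"
  shows "edge_count Q Q \<le> 10"
proof -
  obtain p q r s where Q: "Q = {p, q, r, s}" and cycle: "four_cycle p q r s" "adj p r"
    using assms(1) unfolding diamond_def by blast
  have "\<not> adj q s" using assms(2) cycle by (auto simp: Q clique_def four_cycle_def adj_commute)
  hence "N q \<inter> Q \<subseteq> {p, r}" "N s \<inter> Q \<subseteq> {p, r}" by (auto simp: Q adj_commute)
  hence "deg_in Q q \<le> card {p, r}" "deg_in Q s \<le> card {p, r}" by (intro card_mono; simp)+
  moreover have "deg_in Q p \<le> 3" "deg_in Q r \<le> 3"
    using deg_in_less_card[of Q p] deg_in_less_card[of Q r] diamond_card[OF assms(1)]
    by (auto simp: Q)
  ultimately show ?thesis using cycle by (simp add: Q edge_count_def four_cycle_def)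
qed

lemma diamond_free_edge_count_four_cycle:
  assumes "diamond_free Q" "spans_four_cycle Q"
  shows "edge_count Q Q \<le> 8"
proof -
  have "deg_in Q p \<le> 2" if p: "p \<in> Q" for p
  proof -
    obtain q r s where Q: "Q = {p, q, r, s}" and cycle: "four_cycle p q r s"
      using four_cycle_from[OF assms(2) p] .
    hence "\<not> adj p r" using assms(1) unfolding diamond_free_def diamond_def by blast
    hence "N p \<inter> Q \<subseteq> {q, s}" by (auto simp: Q)
    from card_mono[OF _ this] show ?thesis using cycle by (simp add: four_cycle_def)
  qed
  from edge_count_le[of Q Q, OF this] show ?thesis by (simp add: spans_four_cycle_card[OF assms(2)])
qed

lemma diamonds_subset: "diamonds W \<subseteq> W"
  by (auto simp: diamonds_def)

lemma diamond_subset_diamonds: "Q \<subseteq> W \<Longrightarrow> diamond Q \<Longrightarrow> Q \<subseteq> diamonds W"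
  by (auto simp: diamonds_def)

lemma in_diamondsE:
  assumes "s \<in> diamonds W"
  obtains Q where "Q \<subseteq> W" "diamond Q" "s \<in> Q"
  using assms by (auto simp: diamonds_def)

lemma diamonds_closed:
  assumes "path5_free W"
  shows "closed_in W (diamonds W)"
proof (rule closed_inI[OF diamonds_subset])
  fix s u assume su: "s \<in> diamonds W" "u \<in> W" "adj s u"
  then obtain Q where "Q \<subseteq> W" "diamond Q" "s \<in> Q" by (elim in_diamondsE)
  thus "u \<in> diamonds W"
    using closed_inD[OF diamond_closed[OF assms]] diamond_subset_diamonds su by blast
qed

lemma diamonds_degree_le_3:
  assumes "path5_free W" "s \<in> diamonds W"
  shows "deg_in W s \<le> 3"
proof -
  obtain Q where Q: "Q \<subseteq> W" "diamond Q" "s \<in> Q" using assms(2) by (elim in_diamondsE)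
  have "deg_in W s = deg_in Q s"
    using closed_in_N_Int[OF diamond_closed[OF assms(1) Q(2,1)] Q(3)] by simp
  thus ?thesis using deg_in_less_card[OF diamond_finite[OF Q(2)] Q(3)] diamond_card[OF Q(2)] by simp
qed

lemma diamonds_eq_if_meet:
  assumes "path5_free W" and Q: "Q \<subseteq> W" "diamond Q" and Q': "Q' \<subseteq> W" "diamond Q'"
    and p: "p \<in> Q" "p \<in> Q'"
  shows "Q = Q'"
proof -
  obtain q r s where Q'_eq: "Q' = {p, q, r, s}" and cycle: "four_cycle p q r s"
    using four_cycle_from[OF diamond_spans_four_cycle[OF Q'(2)] p(2)] .
  have reach: "y \<in> Q" if "x \<in> Q" "y \<in> Q'" "adj x y" for x y
    using closed_inD[OF diamond_closed[OF assms(1) Q(2,1)]] that Q'(1) by blast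
  have "q \<in> Q" using reach[of p q] p(1) cycle by (simp add: Q'_eq four_cycle_def)
  moreover have "s \<in> Q"
    using reach[of p s] p(1) cycle by (simp add: Q'_eq four_cycle_def adj_commute)
  moreover have "r \<in> Q" using reach[of q r] \<open>q \<in> Q\<close> cycle by (simp add: Q'_eq four_cycle_def)
  ultimately have "Q' \<subseteq> Q" using p(1) by (simp add: Q'_eq)
  thus ?thesis
    using card_subset_eq[OF diamond_finite[OF Q(2)]] diamond_card Q(2) Q'(2) by metis
qed

lemma diamonds_eq_or_card_ge_8:
  assumes "path5_free W" "finite W" and Q: "Q \<subseteq> W" "diamond Q"
  shows "diamonds W = Q \<or> 8 \<le> card (diamonds W)"
proof (cases "diamonds W = Q")
  case False
  then obtain s Q' where s: "s \<in> Q'" "s \<notin> Q" and Q': "Q' \<subseteq> W" "diamond Q'"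
    using diamond_subset_diamonds[OF Q] unfolding diamonds_def by blast
  have "Q \<inter> Q' = {}" using diamonds_eq_if_meet[OF assms(1) Q Q'] s by blast
  hence "card (Q \<union> Q') = 8"
    by (simp add: card_Un_disjoint diamond_finite diamond_card Q(2) Q'(2))
  moreover have "card (Q \<union> Q') \<le> card (diamonds W)"
    using diamond_subset_diamonds[OF Q] diamond_subset_diamonds[OF Q']
      finite_subset[OF diamonds_subset assms(2)] by (intro card_mono) auto
  ultimately show ?thesis by simp
qed simp

lemma claw_neighbour_closed:
  assumes "path5_free W" and min_degree: "\<And>s. s \<in> W \<Longrightarrow> 2 \<le> deg_in W s"
    and claw: "w \<in> W" "{a, b, c} \<subseteq> W" "distinct [a, b, c]" "adj w a" "adj w b" "adj w c"
    and u: "u \<in> W" "adj a u" "u \<noteq> w"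
  shows "u \<in> {b, c}"
proof (rule ccontr)
  assume outside: "u \<notin> {b, c}"
  have distinct: "distinct [u, a, b, c, w]" using claw u outside by auto
  have "b \<in> W" using claw by simp
  then obtain y where y: "y \<in> W" "adj b y" "y \<noteq> w"
    using second_neighbour[OF min_degree] by metis
  have "y \<noteq> b" using y by auto
  note no_path = path5_freeD[OF assms(1)]
  consider "y = a" | "y = c" | "y = u" | "y \<notin> {a, b, c, u}" using \<open>y \<noteq> b\<close> by blast
  thus False
  proof cases
    case 1 thus False using no_path[of u a b w c] claw u y distinct by (auto simp: adj_commute)
  next
    case 2 thus False using no_path[of u a w b c] claw u y distinct by (auto simp: adj_commute)
  next
    case 3 thus False using no_path[of c w b u a] claw u y distinct by (auto simp: adj_commute)
  next
    case 4 thus False using no_path[of u a w b y] claw u y distinct by (auto simp: adj_commute)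
  qed
qed

lemma min_degree_2_claw_has_diamond:
  assumes "path5_free W" and min_degree: "\<And>s. s \<in> W \<Longrightarrow> 2 \<le> deg_in W s"
    and w: "w \<in> W" "3 \<le> deg_in W w"
  shows "\<not> diamond_free W"
proof -
  obtain a b c where abc: "{a, b, c} \<subseteq> W" "distinct [a, b, c]" "adj w a" "adj w b" "adj w c"
    using w(2) by (auto elim!: card_ge_3E)
  have spokes: "\<forall>x\<in>{a, b, c}. adj w x" using abc(3-5) by simp
  have inner: "adj x y \<or> adj x z" if "{x, y, z} = {a, b, c}" "distinct [x, y, z]" for x y z
  proof -
    have claw: "{x, y, z} \<subseteq> W" "adj w x" "adj w y" "adj w z"
      using abc(1) spokes unfolding that(1)[symmetric] by simp_all
    then obtain u where u: "u \<in> W" "adj x u" "u \<noteq> w"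
      using second_neighbour[OF min_degree[of x]] by auto
    have "u \<in> {y, z}"
      by (rule claw_neighbour_closed[OF assms(1) min_degree w(1) claw(1) that(2) claw(2-4) u])
    thus ?thesis using u(2) by blast
  qed
  have square: "diamond {w, x, y, z}"
    if "adj x y" "adj y z" "{x, y, z} = {a, b, c}" "x \<noteq> z" for x y z
  proof -
    have "adj w x" "adj w y" "adj w z" using spokes unfolding that(3)[symmetric] by simp_all
    moreover from this have "distinct [w, x, y, z]" using that(1,2,4) by auto
    ultimately show ?thesis
      using that(1,2) by (intro diamondI) (simp_all add: four_cycle_def adj_commute)
  qed
  have "adj a b \<or> adj a c" "adj b a \<or> adj b c" "adj c a \<or> adj c b"
    using inner[of a b c] inner[of b a c] inner[of c a b] abc(2) by (auto simp: insert_commute)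
  hence "diamond {w, a, b, c} \<or> diamond {w, b, a, c} \<or> diamond {w, a, c, b}"
    using square[of a b c] square[of b a c] square[of a c b] abc(2) adj_commute
    by (auto simp: insert_commute)
  moreover have "{w, a, b, c} \<subseteq> W" "{w, b, a, c} \<subseteq> W" "{w, a, c, b} \<subseteq> W"
    using abc(1) w(1) by auto
  ultimately show ?thesis unfolding diamond_free_def by meson
qed

lemma edge_count_le_twice_card:
  assumes "finite W" "path5_free W" "diamond_free W"
  shows "edge_count W W \<le> 2 * card W"
proof (rule ccontr)
  assume dense: "\<not> ?thesis"
  hence "W \<noteq> {}" "2 * card W \<le> edge_count W W + 1" by auto
  then obtain V where V: "V \<subseteq> W" "\<forall>s\<in>V. 2 \<le> deg_in V s"
    "edge_count W W + 2 * card V \<le> edge_count V V + 2 * card W"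
    using min_degree_2_core[OF assms(1)] by metis
  have "\<not> edge_count V V \<le> card V * 2" using V(3) dense by simp
  then obtain w where "w \<in> V" "3 \<le> deg_in V w" using edge_count_le[of V V 2] by force
  hence "\<not> diamond_free V"
    using min_degree_2_claw_has_diamond path5_free_subset assms(2) V(1,2) by blast
  thus False using diamond_free_subset assms(3) V(1) by blast
qed

lemma dense_has_short_cycle [consumes 4, case_names triangle square]:
  assumes "finite W" "path5_free W" "W \<noteq> {}" "2 * card W \<le> edge_count W W + 1"
  obtains (triangle) T where "T \<subseteq> W" "clique T" "card T = 3"
  | (square) Q where "Q \<subseteq> W" "spans_four_cycle Q"
proof -
  obtain V where V: "V \<subseteq> W" "V \<noteq> {}" "\<forall>s\<in>V. 2 \<le> deg_in V s"
    using min_degree_2_core assms(1,3,4) by metis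
  then obtain p where p: "p \<in> V" by blast
  then obtain q r where qr: "q \<in> V" "r \<in> V" "adj p q" "adj p r" "q \<noteq> r"
    using V(3) by (auto elim!: card_ge_2E)
  obtain q' where q': "q' \<in> V" "adj q q'" "q' \<noteq> p" using second_neighbour V(3) qr(1) by metis
  obtain r' where r': "r' \<in> V" "adj r r'" "r' \<noteq> p" using second_neighbour V(3) qr(2) by metis
  have distinct: "distinct [p, q, r]" "q \<noteq> q'" "r \<noteq> r'" using qr q' r' by auto
  consider "adj q r" | "q' = r'" "q' \<noteq> r" | "q' \<noteq> r" "r' \<noteq> q" "q' \<noteq> r'"
    using q'(2) r'(2) adj_commute by blast
  thus ?thesis
  proof cases
    case 1
    hence "clique {p, q, r}" using qr by (auto simp: clique_def adj_commute)
    thus ?thesis using triangle[of "{p, q, r}"] p qr V(1) distinct by auto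
  next
    case 2
    hence "four_cycle p q q' r" using qr q' r' distinct by (auto simp: four_cycle_def adj_commute)
    thus ?thesis using square[of "{p, q, q', r}"] p qr q' V(1) by (auto simp: spans_four_cycle_def)
  next
    case 3
    hence False
      using path5_freeD[OF assms(2), of q' q p r r'] p qr q' r' V(1) distinct
      by (auto simp: adj_commute)
    thus ?thesis ..
  qed
qed

lemma edge_count_off_diamonds:
  assumes "finite W" "path5_free W"
  shows "edge_count (W - diamonds W) (W - diamonds W) \<le> 2 * card (W - diamonds W)"
proof (rule edge_count_le_twice_card)
  show "diamond_free (W - diamonds W)"
    unfolding diamond_free_def
  proof (intro allI impI notI)
    fix Q assume Q: "Q \<subseteq> W - diamonds W" "diamond Q"
    hence "Q \<subseteq> diamonds W" using diamond_subset_diamonds[of Q W] by blast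
    hence "Q = {}" using Q(1) by blast
    thus False using diamond_card[OF Q(2)] by simp
  qed
qed (use assms path5_free_subset in auto)

lemma edge_count_le_diamonds:
  assumes "finite W" "path5_free W"
  shows "edge_count W W \<le> 2 * card W + card (diamonds W)"
proof -
  note closed = diamonds_closed[OF assms(2)]
  have "edge_count (diamonds W) (diamonds W) \<le> card (diamonds W) * 3"
    unfolding closed_in_edge_count[OF closed, symmetric]
    by (intro edge_count_le diamonds_degree_le_3[OF assms(2)])
  thus ?thesis
    using edge_count_closed_split[OF assms(1) closed] edge_count_off_diamonds[OF assms]
      closed_in_card_Diff[OF assms(1) closed] by simp
qed

lemma triangleE:
  assumes "clique T" "card T = 3" "a \<in> T"
  obtains b c where "T = {a, b, c}" "distinct [a, b, c]" "adj a b" "adj a c" "adj b c"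
proof -
  have "card (T - {a}) = 2" using assms(2,3) by (simp add: card_Diff_singleton)
  then obtain b c where bc: "T - {a} = {b, c}" "b \<noteq> c" by (auto simp: card_2_iff)
  hence T: "T = {a, b, c}" and distinct: "distinct [a, b, c]" using assms(3) by auto
  hence "adj a b" "adj a c" "adj b c" using cliqueD[OF assms(1)] by auto
  thus ?thesis using that T distinct by blast
qed

definition pendant_triangle :: "'a set \<Rightarrow> 'a set \<Rightarrow> 'a \<Rightarrow> bool" where
  "pendant_triangle W T a \<longleftrightarrow> T \<subseteq> W \<and> clique T \<and> card T = 3 \<and> a \<in> T \<and>
     (\<forall>x\<in>T - {a}. N x \<inter> W = T - {x})"

lemma triangle_one_attachment:
  assumes "path5_free W" "diamond_free W" and T: "T \<subseteq> W" "clique T" "card T = 3"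
    and p: "p \<in> T" "x \<in> N p \<inter> W - T" and q: "q \<in> T" "y \<in> N q \<inter> W - T"
  shows "p = q"
proof (rule ccontr)
  assume "p \<noteq> q"
  then obtain r where r: "r \<in> T" "r \<noteq> p" "r \<noteq> q"
    using triangleE[OF T(2,3) p(1)] q(1) by (metis distinct_length_2_or_more insertCI)
  have sides: "adj p q" "adj p r" "adj r q" using cliqueD[OF T(2)] p(1) q(1) r \<open>p \<noteq> q\<close> by auto
  show False
  proof (cases "x = y")
    case True
    hence "four_cycle p x q r" using p q r sides \<open>p \<noteq> q\<close> by (auto simp: four_cycle_def adj_commute)
    hence "diamond {p, x, q, r}" using sides(1) by (rule diamondI)
    moreover have "{p, x, q, r} \<subseteq> W" using p q(1) r T(1) by auto
    ultimately show False using diamond_freeD[OF assms(2)] by blast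
  next
    case False
    have "{x, p, r, q, y} \<subseteq> W" using p q r(1) T(1) by auto
    moreover have "distinct [x, p, r, q, y]" using p q r False \<open>p \<noteq> q\<close> by auto
    moreover have "adj x p" "adj q y" using p(2) q(2) by (auto simp: adj_commute)
    ultimately show False using path5_freeD[OF assms(1)] sides(2,3) by metis
  qed
qed

lemma triangle_is_pendant:
  assumes "path5_free W" "diamond_free W" and T: "T \<subseteq> W" "clique T" "card T = 3"
  obtains a where "pendant_triangle W T a"
proof -
  have "\<exists>a\<in>T. \<forall>x\<in>T - {a}. N x \<inter> W \<subseteq> T"
  proof (cases "\<exists>a\<in>T. \<not> N a \<inter> W \<subseteq> T")
    case True
    then obtain a y where a: "a \<in> T" "y \<in> N a \<inter> W - T" by blast
    have "N x \<inter> W \<subseteq> T" if "x \<in> T - {a}" for x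
      using triangle_one_attachment[OF assms(1,2) T a, of x] that by blast
    thus ?thesis using a(1) by blast
  next
    case False
    moreover have "T \<noteq> {}" using T(3) by auto
    ultimately show ?thesis by blast
  qed
  then obtain a where a: "a \<in> T" "\<forall>x\<in>T - {a}. N x \<inter> W \<subseteq> T" by blast
  have "N x \<inter> W = T - {x}" if "x \<in> T - {a}" for x
    using a(2) that T(1,2) by (auto simp: clique_def)
  thus ?thesis using that a(1) T unfolding pendant_triangle_def by blast
qed

lemma pendant_triangle_leaf:
  assumes "path5_free W" and T: "pendant_triangle W T a" and x: "x \<in> N a \<inter> W - T"
  shows "N x \<inter> W = {a}"
proof -
  have triangle: "T \<subseteq> W" "clique T" "card T = 3" "a \<in> T"
    using T by (simp_all add: pendant_triangle_def)
  obtain b c where bc: "T = {a, b, c}" "distinct [a, b, c]" "adj a b" "adj a c" "adj b c"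
    using triangleE[OF triangle(2-4)] .
  have "a \<in> N x \<inter> W" using x triangle(1,4) by (auto simp: adj_commute)
  moreover have "y = a" if y: "adj x y" "y \<in> W" for y
  proof (rule ccontr)
    assume "y \<noteq> a"
    have "y \<notin> T"
    proof
      assume "y \<in> T"
      hence "N y \<inter> W = T - {y}" using T \<open>y \<noteq> a\<close> by (simp add: pendant_triangle_def)
      moreover have "x \<in> N y \<inter> W" using x y(1) by (simp add: adj_commute)
      ultimately show False using x by blast
    qed
    moreover have "x \<notin> T" "x \<noteq> y" using x y by auto
    ultimately have "distinct [y, x, a, b, c]" using bc(1,2) by simp
    moreover have "{y, x, a, b, c} \<subseteq> W" using x y triangle(1) bc(1) by auto
    moreover have "adj y x" "adj x a" using x y by (auto simp: adj_commute)
    ultimately show False using path5_freeD[OF assms(1)] bc(3,5) by metis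
  qed
  ultimately show ?thesis unfolding N_def by blast
qed

lemma pendant_triangle_closed:
  assumes "path5_free W" and T: "pendant_triangle W T a"
  shows "closed_in W (T \<union> (N a \<inter> W))"
proof (rule closed_inI)
  have triangle: "T \<subseteq> W" "a \<in> T" using T by (simp_all add: pendant_triangle_def)
  show "T \<union> (N a \<inter> W) \<subseteq> W" using triangle(1) by auto
  fix s u assume s: "s \<in> T \<union> (N a \<inter> W)" and "u \<in> W" "adj s u"
  hence u: "u \<in> N s \<inter> W" by simp
  consider "s = a" | "s \<in> T - {a}" | "s \<in> N a \<inter> W - T" using s by blast
  thus "u \<in> T \<union> (N a \<inter> W)"
  proof cases
    case 1 thus ?thesis using u by blast
  next
    case 2
    hence "N s \<inter> W = T - {s}" using T by (simp add: pendant_triangle_def)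
    thus ?thesis using u by blast
  next
    case 3
    have "u \<in> {a}" using u unfolding pendant_triangle_leaf[OF assms 3] .
    thus ?thesis using triangle(2) by simp
  qed
qed

lemma pendant_triangle_edge_count:
  assumes "finite W" "path5_free W" and T: "pendant_triangle W T a"
  shows "edge_count (T \<union> (N a \<inter> W)) (T \<union> (N a \<inter> W)) = 2 * card (T \<union> (N a \<inter> W))"
proof -
  let ?P = "N a \<inter> W - T" and ?C = "T \<union> (N a \<inter> W)"
  have triangle: "T \<subseteq> W" "clique T" "card T = 3" "a \<in> T"
    using T by (simp_all add: pendant_triangle_def)
  have finT: "finite T" and P: "finite ?P" "T \<inter> ?P = {}"
    using assms(1) finite_subset[OF triangle(1)] by auto
  have "T - {a} \<subseteq> N a \<inter> W" unfolding N_def using triangle(1) cliqueD[OF triangle(2,4)] by blast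
  hence "N a \<inter> W = (T - {a}) \<union> ?P" using triangle(4) by auto
  hence "deg_in W a = card ((T - {a}) \<union> ?P)" by (rule arg_cong)
  also have "\<dots> = 2 + card ?P" using triangle(3,4) finT P by (subst card_Un_disjoint) auto
  finally have "deg_in W a = 2 + card ?P" .
  moreover have "deg_in W x = 2" if "x \<in> T - {a}" for x
  proof -
    have "N x \<inter> W = T - {x}" using T that by (simp add: pendant_triangle_def)
    thus ?thesis using that triangle(3) finT by simp
  qed
  ultimately have "edge_count T W = 6 + card ?P"
    using triangle(3,4) finT by (simp add: edge_count_def sum.remove[of T a])
  moreover have "edge_count ?P W = card ?P"
    using pendant_triangle_leaf[OF assms(2) T] by (simp add: edge_count_def)
  moreover have "?C = T \<union> ?P" by auto
  ultimately show ?thesis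
    using closed_in_edge_count[OF pendant_triangle_closed[OF assms(2) T]] edge_count_Un_left[OF finT P]
      card_Un_disjoint[OF finT P] triangle(3) by simp
qed

end

definition oblong :: "nat \<Rightarrow> nat" where
  "oblong m = m * (m + 1)"

lemma oblong_mono: "k \<le> m \<Longrightarrow> oblong k \<le> oblong m"
  unfolding oblong_def by (intro mult_le_mono) auto

context adjacency
begin

definition oblong_sum :: "'a set \<Rightarrow> nat" where
  "oblong_sum W = (\<Sum>s\<in>W. oblong (deg_in W s))"

lemma oblong_sum_closed_split:
  assumes "finite W" "closed_in W R"
  shows "oblong_sum W = oblong_sum R + oblong_sum (W - R)"
proof -
  have part: "(\<Sum>s\<in>V. oblong (deg_in W s)) = oblong_sum V" if "closed_in W V" for V
    unfolding oblong_sum_def by (rule sum.cong) (simp_all add: closed_in_N_Int[OF that])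
  have "oblong_sum W = (\<Sum>s\<in>R. oblong (deg_in W s)) + (\<Sum>s\<in>W - R. oblong (deg_in W s))"
    unfolding oblong_sum_def
    using sum.subset_diff[OF closed_in_subset[OF assms(2)] assms(1)] by (simp add: add.commute)
  thus ?thesis using part[OF assms(2)] part[OF closed_in_Diff[OF closed_in_refl assms(2)]] by simp
qed

lemma oblong_sum_le_max_degree:
  assumes "finite W" "path5_free W" "diamond_free W" "\<And>s. s \<in> W \<Longrightarrow> deg_in W s \<le> D"
  shows "oblong_sum W \<le> 2 * card W * (D + 1)"
proof -
  have "oblong_sum W \<le> (\<Sum>s\<in>W. deg_in W s * (D + 1))"
    unfolding oblong_sum_def oblong_def using assms(4) by (intro sum_mono mult_left_mono) auto
  also have "\<dots> = edge_count W W * (D + 1)" by (simp only: edge_count_def sum_distrib_right)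
  also have "\<dots> \<le> 2 * card W * (D + 1)"
    by (intro mult_right_mono edge_count_le_twice_card assms(1-3)) simp
  finally show ?thesis .
qed

lemma oblong_sum_le:
  assumes "finite W" "path5_free W" "diamond_free W"
  shows "oblong_sum W \<le> 2 * card W * card W"
proof (cases "W = {}")
  case False
  hence "card W \<noteq> 0" using assms(1) by simp
  moreover have "deg_in W s \<le> card W - 1" if "s \<in> W" for s
    using deg_in_less_card[OF assms(1) that] by simp
  ultimately show ?thesis using oblong_sum_le_max_degree[OF assms, of "card W - 1"] by simp
qed (simp add: oblong_sum_def)

lemma neighbourhood_edge_unique:
  assumes "path5_free W" "diamond_free W" "w \<in> W"
    and xy: "x \<in> N w \<inter> W" "y \<in> N w \<inter> W" "adj x y"
    and pq: "p \<in> N w \<inter> W" "q \<in> N w \<inter> W" "adj p q"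
  shows "{x, y} = {p, q}"
proof (rule ccontr)
  assume differ: "{x, y} \<noteq> {p, q}"
  have no_path: "b = d" if "{b, c, d} \<subseteq> N w \<inter> W" "adj b c" "adj c d" for b c d
  proof (rule ccontr)
    assume "b \<noteq> d"
    hence "four_cycle w b c d" using that by (auto simp: four_cycle_def adj_commute)
    hence "diamond {w, b, c, d}" using that(1) by (intro diamondI) auto
    moreover have "{w, b, c, d} \<subseteq> W" using that(1) assms(3) by auto
    ultimately show False using diamond_freeD[OF assms(2)] by blast
  qed
  consider "{x, y} \<inter> {p, q} = {}" | "x = p" "y \<noteq> q" | "x = q" "y \<noteq> p" | "y = p" "x \<noteq> q" | "y = q" "x \<noteq> p"
    using differ by blast
  thus False
  proof cases
    case 1
    hence "distinct [x, y, w, p, q]" using xy pq by auto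
    thus False using path5_freeD[OF assms(1), of x y w p q] assms(3) xy pq
      by (auto simp: adj_commute)
  next
    case 2 thus False using no_path[of y x q] xy pq by (auto simp: adj_commute)
  next
    case 3 thus False using no_path[of y x p] xy pq by (auto simp: adj_commute)
  next
    case 4 thus False using no_path[of x y q] xy pq by (auto simp: adj_commute)
  next
    case 5 thus False using no_path[of x y p] xy pq by (auto simp: adj_commute)
  qed
qed

lemma deg_in_universal:
  assumes "finite C" "w \<in> C" "C - {w} \<subseteq> N w"
  shows "deg_in C w = card C - 1"
proof -
  have "w \<notin> N w" by simp
  hence "N w \<inter> C = C - {w}" using assms(3) by blast
  thus ?thesis using assms(1,2) by simp
qed

lemma oblong_sum_star:
  assumes "finite C" "w \<in> C" "C - {w} \<subseteq> N w"
    and independent: "\<And>x y. x \<in> C - {w} \<Longrightarrow> y \<in> C - {w} \<Longrightarrow> \<not> adj x y"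
  shows "oblong_sum C < oblong (card C)"
proof -
  have leaf: "oblong (deg_in C s) \<le> 2" if s: "s \<in> C - {w}" for s
  proof -
    have "N s \<inter> C \<subseteq> {w}" using independent[OF s] unfolding N_def by blast
    from card_mono[OF _ this] have "deg_in C s \<le> 1" by simp
    from oblong_mono[OF this] show ?thesis by (simp add: oblong_def)
  qed
  have "(\<Sum>s\<in>C - {w}. oblong (deg_in C s)) \<le> (card C - 1) * 2"
    using sum_bounded_above[of "C - {w}" "\<lambda>s. oblong (deg_in C s)" 2] leaf assms(1,2) by simp
  hence "oblong_sum C \<le> oblong (card C - 1) + 2 * (card C - 1)"
    unfolding oblong_sum_def using assms(1,2)
    by (simp add: sum.remove deg_in_universal[OF assms(1-3)])
  moreover have "card C \<noteq> 0" using assms(1,2) by auto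
  then obtain m where "card C = Suc m" using not0_implies_Suc by blast
  ultimately show ?thesis by (simp add: oblong_def)
qed

lemma star_with_edge_degrees:
  assumes "finite C" "w \<in> C" and pq: "p \<in> C - {w}" "q \<in> C - {w}"
    and edge: "\<And>x y. x \<in> C - {w} \<Longrightarrow> y \<in> C - {w} \<Longrightarrow> adj x y \<Longrightarrow> {x, y} = {p, q}"
  shows "s \<in> {p, q} \<Longrightarrow> deg_in C s \<le> 2" and "s \<in> C - {w} - {p, q} \<Longrightarrow> deg_in C s \<le> 1"
proof -
  have inner: "{s, x} = {p, q}" if "s \<in> C - {w}" "x \<in> N s \<inter> C" "x \<noteq> w" for s x
    using edge[of s x] that by auto
  show "deg_in C s \<le> 2" if s: "s \<in> {p, q}"
  proof -
    have "x \<in> {w, p, q} - {s}" if x: "x \<in> N s \<inter> C" for x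
    proof -
      have "x \<noteq> s" using x by auto
      thus ?thesis using inner[OF _ x] s pq by blast
    qed
    hence "N s \<inter> C \<subseteq> {w, p, q} - {s}" by blast
    from card_mono[OF _ this] show ?thesis
      using s pq by (auto simp: card_insert_if card_Diff_singleton_if split: if_splits)
  qed
  show "deg_in C s \<le> 1" if s: "s \<in> C - {w} - {p, q}"
  proof -
    have "N s \<inter> C \<subseteq> {w}" using inner[of s] s by blast
    from card_mono[OF _ this] show ?thesis by simp
  qed
qed

lemma oblong_sum_universal_le:
  assumes "finite C" "path5_free C" "diamond_free C" "w \<in> C" "C - {w} \<subseteq> N w"
  shows "oblong_sum C \<le> oblong (card C) + 6"
proof (cases "\<exists>p\<in>C - {w}. \<exists>q\<in>C - {w}. adj p q")
  case True
  then obtain p q where pq: "p \<in> C - {w}" "q \<in> C - {w}" "adj p q" by blast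
  hence "p \<noteq> q" by auto
  have edge: "{x, y} = {p, q}" if "x \<in> C - {w}" "y \<in> C - {w}" "adj x y" for x y
    by (rule neighbourhood_edge_unique[OF assms(2-4)]) (use assms(5) that pq in auto)
  note degrees = star_with_edge_degrees[OF assms(1,4) pq(1,2) edge]
  have "oblong (deg_in C p) \<le> 6" "oblong (deg_in C q) \<le> 6"
    using oblong_mono[of "deg_in C p" 2] oblong_mono[of "deg_in C q" 2] degrees(1)
    by (simp_all add: oblong_def)
  moreover have "oblong (deg_in C s) \<le> 2" if "s \<in> C - {w} - {p, q}" for s
    using oblong_mono[OF degrees(2)[OF _ _ _ that]] by (simp add: oblong_def)
  hence "(\<Sum>s\<in>C - {w} - {p, q}. oblong (deg_in C s)) \<le> card (C - {w} - {p, q}) * 2"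
    using sum_bounded_above[of "C - {w} - {p, q}" "\<lambda>s. oblong (deg_in C s)" 2] by simp
  moreover have "card (C - {w} - {p, q}) = card C - 3"
    using pq \<open>p \<noteq> q\<close> assms(1,4) by (simp add: card_Diff_subset)
  moreover have "oblong_sum C = oblong (deg_in C w) + (\<Sum>s\<in>{p, q}. oblong (deg_in C s))
      + (\<Sum>s\<in>C - {w} - {p, q}. oblong (deg_in C s))"
    unfolding oblong_sum_def using assms(1,4) pq
    by (simp add: sum.remove[of C w] sum.subset_diff[of "{p, q}" "C - {w}"])
  ultimately have "oblong_sum C \<le> oblong (card C - 1) + 12 + 2 * (card C - 3)"
    using \<open>p \<noteq> q\<close> by (simp add: deg_in_universal[OF assms(1,4,5)])
  moreover have "3 \<le> card C" using card_mono[of C "{w, p, q}"] assms(1,4) pq \<open>p \<noteq> q\<close> by auto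
  then obtain m where "card C = m + 3" by (metis le_add_diff_inverse2)
  ultimately show ?thesis by (simp add: oblong_def algebra_simps)
next
  case False
  thus ?thesis using oblong_sum_star[OF assms(1,4,5)] by fastforce
qed

lemma ex_third_neighbour:
  assumes "3 \<le> deg_in W w"
  obtains c where "c \<in> N w \<inter> W" "c \<noteq> a" "c \<noteq> b"
proof -
  have "\<not> N w \<inter> W \<subseteq> {a, b}"
  proof
    assume "N w \<inter> W \<subseteq> {a, b}"
    from card_mono[OF _ this] show False using assms by (auto simp: card_insert_if split: if_splits)
  qed
  thus ?thesis using that by blast
qed

lemma double_star_inner_leaf:
  assumes "path5_free W" "w \<in> W" and a: "a \<in> N w \<inter> W" and u: "u \<in> W - insert w (N w)" "adj a u"
    and D: "3 \<le> deg_in W w" and b: "b \<in> N w \<inter> W - {a}"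
  shows "N b \<inter> W = {w}"
proof -
  note no_path = path5_freeD[OF assms(1)]
  obtain c where c: "c \<in> N w \<inter> W" "c \<noteq> a" "c \<noteq> b" using ex_third_neighbour[OF D] .
  have distinct: "distinct [u, a, b, w, c]" using a u b c by auto
  have "\<not> (adj b y \<and> y \<in> W \<and> y \<noteq> w)" for y
  proof
    assume y: "adj b y \<and> y \<in> W \<and> y \<noteq> w"
    hence "y \<noteq> b" by auto
    then consider "y = a" | "y = u" | "y \<notin> {u, a, b, w}" using y by blast
    thus False
    proof cases
      case 1 thus False
        using no_path[of u a b w c] distinct a u b c y assms(2) by (auto simp: adj_commute)
    next
      case 2 thus False
        using no_path[of c w b u a] distinct a u b c y assms(2) by (auto simp: adj_commute)
    next
      case 3 thus False
        using no_path[of u a w b y] distinct a u b y assms(2) by (auto simp: adj_commute)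
    qed
  qed
  moreover have "w \<in> N b \<inter> W" using b assms(2) by (simp add: adj_commute)
  ultimately show ?thesis unfolding N_def by blast
qed

lemma double_star_outer_leaf:
  assumes "path5_free W" "w \<in> W" and a: "a \<in> N w \<inter> W" and u: "u \<in> W - insert w (N w)" "adj a u"
    and D: "3 \<le> deg_in W w" and x: "x \<in> N a \<inter> W - {w}"
  shows "N x \<inter> W = {a}"
proof -
  note inner = double_star_inner_leaf[OF assms(1,2) a u D]
  have basic: "a \<noteq> w" "a \<in> W" "adj w a" "x \<noteq> a" using a x by auto
  have xa: "a \<in> N x \<inter> W" using x basic by (simp add: adj_commute)
  hence "x \<notin> N w" using inner[of x] x basic by blast
  obtain c where c: "c \<in> N w \<inter> W" "c \<noteq> a" using ex_third_neighbour[OF D] .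
  have "\<not> (adj x y \<and> y \<in> W \<and> y \<noteq> a)" for y
  proof
    assume y: "adj x y \<and> y \<in> W \<and> y \<noteq> a"
    have "x \<in> N y \<inter> W" using x y by (simp add: adj_commute)
    hence "y \<notin> N w" using inner[of y] x y by blast
    moreover have "y \<noteq> w" using y \<open>x \<notin> N w\<close> by (auto simp: adj_commute)
    moreover have "x \<noteq> y" using y by auto
    ultimately have "distinct [y, x, a, w, c]" using x y c basic \<open>x \<notin> N w\<close> by auto
    thus False using path5_freeD[OF assms(1), of y x a w c] x y c basic assms(2)
      by (auto simp: adj_commute)
  qed
  thus ?thesis using xa unfolding N_def by blast
qed

lemma oblong_sum_double_star:
  assumes fin: "finite A" "finite B" and C: "C = insert w (insert a (A \<union> B))"
    and disj: "w \<noteq> a" "w \<notin> A \<union> B" "a \<notin> A \<union> B" "A \<inter> B = {}"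
    and hubs: "N w \<inter> C = insert a A" "N a \<inter> C = insert w B"
    and leaves: "\<And>s. s \<in> A \<union> B \<Longrightarrow> deg_in C s = 1"
  shows "oblong_sum C < oblong (card C)"
proof -
  have "(\<Sum>s\<in>A \<union> B. oblong (deg_in C s)) = 2 * (card A + card B)"
    using leaves fin disj(4) by (simp add: oblong_def card_Un_disjoint)
  moreover have "deg_in C w = card A + 1" "deg_in C a = card B + 1"
    using hubs disj fin by simp_all
  ultimately have "oblong_sum C = oblong (card A + 1) + oblong (card B + 1) + 2 * (card A + card B)"
    unfolding oblong_sum_def using fin disj by (simp add: C)
  moreover have "card C = card A + card B + 2" using fin disj by (simp add: C card_Un_disjoint)
  ultimately show ?thesis by (simp add: oblong_def algebra_simps)
qed

lemma oblong_sum_linked_component: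
  assumes "finite W" "path5_free W" "w \<in> W"
    and a: "a \<in> N w \<inter> W" and u: "u \<in> W - insert w (N w)" "adj a u"
    and D: "3 \<le> deg_in W w"
  obtains C where "closed_in W C" "insert w (N w \<inter> W) \<subseteq> C" "oblong_sum C < oblong (card C)"
proof -
  define A where "A = N w \<inter> W - {a}"
  define B where "B = N a \<inter> W - {w}"
  define C where "C = insert w (insert a (A \<union> B))"
  have leaf_A: "N s \<inter> W = {w}" if "s \<in> A" for s
    using double_star_inner_leaf[OF assms(2,3) a u D] that by (simp add: A_def)
  have leaf_B: "N s \<inter> W = {a}" if "s \<in> B" for s
    using double_star_outer_leaf[OF assms(2,3) a u D] that by (simp add: B_def)
  have C_subset: "C \<subseteq> W" using a assms(3) by (auto simp: C_def A_def B_def)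
  have nbr_w: "N w \<inter> W = insert a A" using a by (auto simp: A_def)
  have nbr_a: "N a \<inter> W = insert w B" using a assms(3) by (auto simp: B_def adj_commute)
  have hubs: "N w \<inter> C = insert a A" "N a \<inter> C = insert w B"
    using C_subset nbr_w nbr_a by (auto simp: C_def)
  have disj: "w \<noteq> a" "w \<notin> A \<union> B" "a \<notin> A \<union> B" "A \<inter> B = {}"
  proof -
    show "w \<noteq> a" "w \<notin> A \<union> B" "a \<notin> A \<union> B" using a by (auto simp: A_def B_def)
    thus "A \<inter> B = {}" using leaf_A leaf_B by (metis disjoint_iff singleton_inject)
  qed
  show thesis
  proof
    show "closed_in W C"
    proof (rule closed_inI[OF C_subset])
      fix s y assume "s \<in> C" "y \<in> W" "adj s y"
      moreover from this have "y \<in> N s \<inter> W" by simp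
      ultimately show "y \<in> C" using leaf_A leaf_B nbr_w nbr_a unfolding C_def by blast
    qed
    show "insert w (N w \<inter> W) \<subseteq> C" unfolding nbr_w by (auto simp: C_def)
    have "deg_in C s = 1" if "s \<in> A \<union> B" for s
    proof -
      have "N s \<inter> C = {w} \<or> N s \<inter> C = {a}"
        using that leaf_A[of s] leaf_B[of s] C_subset by (auto simp: C_def)
      thus ?thesis by auto
    qed
    thus "oblong_sum C < oblong (card C)"
      using oblong_sum_double_star[OF _ _ C_def disj hubs] assms(1) by (auto simp: A_def B_def)
  qed
qed

lemma oblong_sum_component:
  assumes "finite W" "path5_free W" "diamond_free W" "w \<in> W" "3 \<le> deg_in W w"
  obtains C where "closed_in W C" "insert w (N w \<inter> W) \<subseteq> C" "oblong_sum C \<le> oblong (card C) + 6"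
    "oblong_sum C < oblong (card C) \<or> C = insert w (N w \<inter> W)"
proof (cases "closed_in W (insert w (N w \<inter> W))")
  case True
  let ?C = "insert w (N w \<inter> W)"
  have sub: "?C \<subseteq> W" using assms(4) by auto
  have "oblong_sum ?C \<le> oblong (card ?C) + 6"
    using assms(1) path5_free_subset[OF assms(2) sub] diamond_free_subset[OF assms(3) sub]
    by (intro oblong_sum_universal_le[of _ w]) auto
  thus ?thesis using that[OF True] by simp
next
  case False
  then obtain a u where au: "a \<in> insert w (N w \<inter> W)" "u \<in> W" "adj a u" "u \<notin> insert w (N w \<inter> W)"
    using closed_inI[of "insert w (N w \<inter> W)" W] assms(4) by blast
  hence "a \<in> N w \<inter> W" "u \<in> W - insert w (N w)" by auto
  then obtain C where "closed_in W C" "insert w (N w \<inter> W) \<subseteq> C" "oblong_sum C < oblong (card C)"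
    using oblong_sum_linked_component[OF assms(1,2,4) _ _ au(3) assms(5)] by blast
  thus ?thesis using that[of C] by simp
qed

lemma oblong_add_le_imp_zero:
  assumes "oblong (c + r) \<le> oblong c + 6 + 2 * r * r" "r < c" "4 \<le> c"
  shows "r = 0"
proof (rule ccontr)
  assume "r \<noteq> 0"
  have "2 * (r * c) + r \<le> 6 + r * r" using assms(1) by (simp add: oblong_def algebra_simps)
  moreover have "r * r + r \<le> r * c" using mult_le_mono2[of "r + 1" c r] assms(2) by simp
  moreover have "4 * r \<le> r * c" using assms(3) by (simp add: mult.commute)
  ultimately have "r = 1" using \<open>r \<noteq> 0\<close> by linarith
  thus False using \<open>2 * (r * c) + r \<le> 6 + r * r\<close> assms(3) by simp
qed

lemma max_degree_vertex:
  assumes "finite W" "W \<noteq> {}"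
  obtains w where "w \<in> W" "\<And>s. s \<in> W \<Longrightarrow> deg_in W s \<le> deg_in W w"
proof -
  have "Max (deg_in W ` W) \<in> deg_in W ` W" using assms by (intro Max_in) auto
  then obtain w where "w \<in> W" "deg_in W w = Max (deg_in W ` W)" by auto
  thus ?thesis using that assms(1) by simp
qed

lemma oblong_sum_extremal:
  assumes "finite W" "path5_free W" "diamond_free W" "6 \<le> card W" "oblong (card W) \<le> oblong_sum W"
  obtains w p q where "w \<in> W" "W - {w} \<subseteq> N w" "p \<in> W - {w}" "q \<in> W - {w}" "adj p q"
    "\<forall>x\<in>W - {w}. \<forall>y\<in>W - {w}. adj x y \<longrightarrow> {x, y} = {p, q}"
proof -
  have "W \<noteq> {}" using assms(4) by auto
  then obtain w where w: "w \<in> W" "\<And>s. s \<in> W \<Longrightarrow> deg_in W s \<le> deg_in W w"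
    using max_degree_vertex[OF assms(1)] by blast
  have "card W * (card W + 1) \<le> card W * (2 * (deg_in W w + 1))"
    using oblong_sum_le_max_degree[OF assms(1-3) w(2)] assms(5) by (simp add: oblong_def)
  hence half: "card W + 1 \<le> 2 * (deg_in W w + 1)"
    using assms(4) by (subst (asm) mult_le_cancel1) auto
  hence D: "3 \<le> deg_in W w" using assms(4) by presburger
  obtain C where C: "closed_in W C" "insert w (N w \<inter> W) \<subseteq> C" "oblong_sum C \<le> oblong (card C) + 6"
    "oblong_sum C < oblong (card C) \<or> C = insert w (N w \<inter> W)"
    using oblong_sum_component[OF assms(1-3) w(1) D] .
  have finC: "finite C" using closed_in_subset[OF C(1)] assms(1) finite_subset by blast
  have card: "card W = card C + card (W - C)" by (rule closed_in_card_Diff[OF assms(1) C(1)])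
  have "card (W - C) = 0"
  proof (rule oblong_add_le_imp_zero)
    have "oblong_sum (W - C) \<le> 2 * card (W - C) * card (W - C)"
      using assms(1-3) by (intro oblong_sum_le) (auto intro: path5_free_subset diamond_free_subset)
    thus "oblong (card C + card (W - C)) \<le> oblong (card C) + 6 + 2 * card (W - C) * card (W - C)"
      using oblong_sum_closed_split[OF assms(1) C(1)] C(3) assms(5) card by simp
    have "deg_in W w + 1 \<le> card C" using card_mono[OF finC C(2)] assms(1) by simp
    thus "card (W - C) < card C" "4 \<le> card C" using half card D by simp_all
  qed
  hence "W = C" using closed_in_subset[OF C(1)] assms(1) by auto
  hence universal: "W - {w} \<subseteq> N w" using C(4) assms(5) by auto
  obtain p q where pq: "p \<in> W - {w}" "q \<in> W - {w}" "adj p q"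
    using oblong_sum_star[OF assms(1) w(1) universal] assms(5) by force
  moreover have "\<forall>x\<in>W - {w}. \<forall>y\<in>W - {w}. adj x y \<longrightarrow> {x, y} = {p, q}"
    by (intro ballI impI neighbourhood_edge_unique[OF assms(2,3) w(1)]) (use universal pq in auto)
  ultimately show ?thesis by (rule that[OF w(1) universal])
qed

end

section \<open>The signless Laplacian index\<close>

lemma symmetric_mat_has_eigenvalue:
  fixes A :: "real mat"
  assumes A: "A \<in> carrier_mat n n" and n: "n > 0" and sym: "transpose_mat A = A"
  shows "\<exists>k. eigenvalue A k"
proof -
  define B where "B = map_mat complex_of_real A"
  have B: "B \<in> carrier_mat n n" and symB: "transpose_mat B = B"
    using A arg_cong[OF sym, of "map_mat complex_of_real"]
    by (simp_all add: B_def map_mat_transpose)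
  obtain k where k: "eigenvalue B k" using spectrum_non_empty[OF B n] by (auto simp: spectrum_def)
  then obtain y where y: "y \<in> carrier_vec n" "y \<noteq> 0\<^sub>v n" "B *\<^sub>v y = k \<cdot>\<^sub>v y"
    using B unfolding eigenvalue_def eigenvector_def by auto
  have cy: "conjugate y \<in> carrier_vec n" using y(1) by simp
  have conj: "B *\<^sub>v conjugate y = conjugate (B *\<^sub>v y)"
    using A y(1) by (intro eq_vecI) (auto simp: B_def scalar_prod_def)
  have "k * (y \<bullet>c y) = (B *\<^sub>v y) \<bullet> conjugate y"
    using y(1) by (simp add: y(3))
  also have "\<dots> = y \<bullet> (B *\<^sub>v conjugate y)"
    using transpose_vec_mult_scalar[OF B cy y(1)] y(1) cy B by (simp add: symB)
  also have "\<dots> = cnj k * (y \<bullet>c y)"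
    using y(1) by (simp add: conj y(3) conjugate_smult_vec)
  finally have "cnj k = k" using conjugate_square_eq_0_vec[OF y(1)] y(2) by simp
  then obtain r where r: "k = of_real r" by (metis Reals_cnj_iff Reals_cases)
  have "poly (char_poly B) (complex_of_real r) = 0"
    using k unfolding eigenvalue_root_char_poly[OF B] r .
  hence "poly (char_poly A) r = 0" by (simp add: B_def of_real_hom.char_poly_hom[OF A])
  thus ?thesis by (auto simp: eigenvalue_root_char_poly[OF A])
qed

definition adjacent :: "nat set set \<Rightarrow> nat \<Rightarrow> nat \<Rightarrow> bool" where
  "adjacent E u w \<longleftrightarrow> {u, w} \<in> E"

locale fin_graph =
  fixes n :: nat and E :: "nat set set"
  assumes simple: "simple_graph n E"
begin

abbreviation adj :: "nat \<Rightarrow> nat \<Rightarrow> bool" where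
  "adj \<equiv> adjacent E"

lemma adj_less: "adj u w \<Longrightarrow> u < n \<and> w < n \<and> u \<noteq> w"
  using simple unfolding simple_graph_def adjacent_def by (metis doubleton_eq_iff)

sublocale adjacency adj
proof
  show "adj u w \<longleftrightarrow> adj w u" for u w by (simp add: adjacent_def insert_commute)
  show "\<not> adj u u" for u using adj_less by blast
qed

lemma N_subset: "N u \<subseteq> {..<n} - {u}"
  using adj_less by auto

lemma finite_N [simp]: "finite (N u)"
  using N_subset finite_subset by blast

lemma degree_eq_card_N: "degree E u = card (N u)"
proof -
  have "{e \<in> E. u \<in> e} = (\<lambda>w. {u, w}) ` N u"
  proof (intro equalityI subsetI)
    fix e assume "e \<in> {e \<in> E. u \<in> e}"
    moreover from this obtain a b where "e = {a, b}"
      using simple unfolding simple_graph_def by blast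
    ultimately show "e \<in> (\<lambda>w. {u, w}) ` N u"
      by (auto simp: adjacent_def insert_commute)
  qed (auto simp: adjacent_def)
  moreover have "inj_on (\<lambda>w. {u, w}) (N u)" by (auto simp: inj_on_def doubleton_eq_iff)
  ultimately show ?thesis unfolding degree_def by (simp add: card_image)
qed

lemma card_N_pos:
  assumes "no_isolated n E" "u < n"
  shows "1 \<le> card (N u)"
proof -
  obtain e where e: "e \<in> E" "u \<in> e" using assms unfolding no_isolated_def by blast
  then obtain a b where "e = {a, b}" using simple unfolding simple_graph_def by blast
  hence "N u \<noteq> {}" using e by (auto simp: adjacent_def insert_commute N_def)
  thus ?thesis by (simp add: Suc_le_eq card_gt_0_iff)
qed

lemma signless_laplacian_carrier [simp]: "signless_laplacian n E \<in> carrier_mat n n"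
  by (simp add: signless_laplacian_def)

lemma signless_laplacian_mult_vec:
  assumes "z \<in> carrier_vec n" "u < n"
  shows "(signless_laplacian n E *\<^sub>v z) $ u = (\<Sum>w\<in>N u. z $ u + z $ w)"
proof -
  have "(signless_laplacian n E *\<^sub>v z) $ u = (\<Sum>w<n. signless_laplacian n E $$ (u, w) * z $ w)"
    using assms carrier_matD[OF signless_laplacian_carrier]
    by (simp add: scalar_prod_def lessThan_atLeast0)
  also have "\<dots>
      = (\<Sum>w<n. (if u = w then real (degree E u) * z $ w else 0) + (if adj u w then z $ w else 0))"
    using assms(2) by (intro sum.cong) (auto simp: signless_laplacian_def adjacent_def distrib_right)
  also have "\<dots> = real (degree E u) * z $ u + (\<Sum>w<n. if adj u w then z $ w else 0)"
    using assms(2) by (simp add: sum.distrib)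
  also have "(\<Sum>w<n. if adj u w then z $ w else 0) = (\<Sum>w\<in>N u. z $ w)"
  proof -
    have "N u = {w \<in> {..<n}. adj u w}" using adj_less by auto
    thus ?thesis by (simp only: sum.inter_filter finite_lessThan)
  qed
  finally show ?thesis by (simp add: sum.distrib degree_eq_card_N)
qed

lemma finite_eigenvalues: "finite {k. eigenvalue (signless_laplacian n E) k}"
  using card_finite_spectrum(1)[OF signless_laplacian_carrier] by (simp add: spectrum_def)

lemma q_index_ge_eigenvalue:
  assumes "u < n" "z u \<noteq> 0"
    and eigen: "\<And>u. u < n \<Longrightarrow> (\<Sum>w\<in>N u. z u + z w) = k * z u"
  shows "k \<le> q_index n E"
proof -
  have "signless_laplacian n E *\<^sub>v vec n z = k \<cdot>\<^sub>v vec n z"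
  proof (rule eq_vecI)
    fix i assume i: "i < dim_vec (k \<cdot>\<^sub>v vec n z)"
    have "(\<Sum>w\<in>N i. vec n z $ i + vec n z $ w) = (\<Sum>w\<in>N i. z i + z w)"
      using i adj_less by (intro sum.cong) auto
    thus "(signless_laplacian n E *\<^sub>v vec n z) $ i = (k \<cdot>\<^sub>v vec n z) $ i"
      using i signless_laplacian_mult_vec[of "vec n z" i] eigen[of i] by simp
  qed (simp add: carrier_matD(1)[OF signless_laplacian_carrier])
  moreover have "vec n z \<noteq> 0\<^sub>v n" using assms(1,2) by (metis index_vec index_zero_vec(1))
  ultimately have "eigenvalue (signless_laplacian n E) k"
    unfolding eigenvalue_def eigenvector_def using carrier_matD(1)[OF signless_laplacian_carrier]
    by (intro exI[of _ "vec n z"]) simp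
  thus ?thesis unfolding q_index_def by (intro Max_ge finite_eigenvalues) simp
qed

lemma q_index_eigenvector:
  assumes "n > 0"
  obtains z where "z \<in> carrier_vec n" "z \<noteq> 0\<^sub>v n" "signless_laplacian n E *\<^sub>v z = q_index n E \<cdot>\<^sub>v z"
proof -
  have "transpose_mat (signless_laplacian n E) = signless_laplacian n E"
    by (rule eq_matI) (auto simp: signless_laplacian_def insert_commute)
  hence "\<exists>k. eigenvalue (signless_laplacian n E) k"
    by (rule symmetric_mat_has_eigenvalue[OF signless_laplacian_carrier assms])
  hence "q_index n E \<in> {k. eigenvalue (signless_laplacian n E) k}"
    unfolding q_index_def by (intro Max_in finite_eigenvalues) auto
  thus ?thesis using that carrier_matD(1)[OF signless_laplacian_carrier]
    unfolding eigenvalue_def eigenvector_def by auto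
qed

text \<open>The entrywise absolute value of an eigenvector is only a subsolution, but that is all that
  upper bounds on the index need, so no Perron--Frobenius theory is required.\<close>
lemma q_index_subsolution:
  assumes "n > 0"
  obtains z :: "nat \<Rightarrow> real" where "\<And>u. 0 \<le> z u" "\<exists>u<n. 0 < z u"
    "\<And>u. u < n \<Longrightarrow> q_index n E * z u \<le> (\<Sum>w\<in>N u. z u + z w)"
proof -
  obtain y where y: "y \<in> carrier_vec n" "y \<noteq> 0\<^sub>v n" "signless_laplacian n E *\<^sub>v y = q_index n E \<cdot>\<^sub>v y"
    using q_index_eigenvector[OF assms] .
  show ?thesis
  proof
    show "0 \<le> \<bar>y $ u\<bar>" for u by simp
    show "\<exists>u<n. 0 < \<bar>y $ u\<bar>"
    proof (rule ccontr)
      assume "\<not> ?thesis"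
      hence "y = 0\<^sub>v n" using y(1) by (intro eq_vecI) auto
      thus False using y(2) by simp
    qed
    fix u assume u: "u < n"
    have "q_index n E * \<bar>y $ u\<bar> \<le> \<bar>q_index n E * y $ u\<bar>"
      unfolding abs_mult by (intro mult_right_mono) auto
    also have "q_index n E * y $ u = (\<Sum>w\<in>N u. y $ u + y $ w)"
      using signless_laplacian_mult_vec[OF y(1) u] u y(1,3) by simp
    also have "\<bar>\<dots>\<bar> \<le> (\<Sum>w\<in>N u. \<bar>y $ u + y $ w\<bar>)" by (rule sum_abs)
    also have "\<dots> \<le> (\<Sum>w\<in>N u. \<bar>y $ u\<bar> + \<bar>y $ w\<bar>)" by (intro sum_mono abs_triangle_ineq)
    finally show "q_index n E * \<bar>y $ u\<bar> \<le> (\<Sum>w\<in>N u. \<bar>y $ u\<bar> + \<bar>y $ w\<bar>)" .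
  qed
qed

definition far :: "nat \<Rightarrow> nat set" where
  "far v = {..<n} - insert v (N v)"

definition missing :: "nat \<Rightarrow> nat" where
  "missing v = (\<Sum>t\<in>far v. card (N v - N t))"

lemma finite_far [simp]: "finite (far v)"
  by (simp add: far_def)

lemma far_iff: "t \<in> far v \<longleftrightarrow> t < n \<and> t \<noteq> v \<and> \<not> adj v t"
  by (auto simp: far_def)

lemma far_empty_adj: "far v = {} \<Longrightarrow> u < n \<Longrightarrow> u \<noteq> v \<Longrightarrow> adj v u"
  using far_iff[of u v] by auto

lemma card_far: "v < n \<Longrightarrow> card (far v) + card (N v) + 1 = n"
proof -
  assume v: "v < n"
  have sub: "insert v (N v) \<subseteq> {..<n}" using N_subset[of v] v by auto
  have "card (far v) + card (insert v (N v)) = card {..<n}"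
    unfolding far_def using card_Diff_subset[OF _ sub] card_mono[OF _ sub] by simp
  moreover have "v \<notin> N v" by simp
  ultimately show ?thesis by (simp del: in_N)
qed

lemma card_N_Int_Diff: "card (N t \<inter> N v) + card (N v - N t) = card (N v)"
  using card_Int_Diff[of "N v" "N t"] by (simp add: Int_commute)

lemma edge_count_far: "edge_count (N v) (far v) + missing v = card (far v) * card (N v)"
proof -
  have "edge_count (N v) (far v) + missing v = (\<Sum>t\<in>far v. card (N t \<inter> N v) + card (N v - N t))"
    unfolding edge_count_commute[OF finite_N finite_far]
    by (simp only: edge_count_def missing_def sum.distrib)
  thus ?thesis by (simp add: card_N_Int_Diff)
qed

lemma N_split:
  assumes "s \<in> N v"
  shows "N s = insert v (N s \<inter> N v \<union> N s \<inter> far v)"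
  using assms adj_less[of s] by (auto simp: far_iff adj_commute)

lemma card_N_split:
  assumes "s \<in> N v"
  shows "card (N s) = 1 + deg_in (N v) s + deg_in (far v) s"
proof -
  have "card (N s) = card (insert v (N s \<inter> N v \<union> N s \<inter> far v))"
    by (rule arg_cong[OF N_split[OF assms]])
  also have "\<dots> = 1 + card (N s \<inter> N v \<union> N s \<inter> far v)"
    by (subst card_insert_disjoint) (auto simp: far_iff)
  also have "card (N s \<inter> N v \<union> N s \<inter> far v) = deg_in (N v) s + deg_in (far v) s"
    by (rule card_Un_disjoint) (auto simp: far_iff)
  finally show ?thesis by simp
qed

lemma sum_N_split:
  assumes "s \<in> N v" "N s \<inter> far v = {}"
  shows "(\<Sum>w\<in>N s. f w) = f v + (\<Sum>w\<in>N s \<inter> N v. f w)"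
proof -
  have "N s = insert v (N s \<inter> N v)" using N_split[OF assms(1)] assms(2) by simp
  hence "(\<Sum>w\<in>N s. f w) = (\<Sum>w\<in>insert v (N s \<inter> N v). f w)" by (rule arg_cong)
  thus ?thesis by (subst (asm) sum.insert) auto
qed

lemma sum_card_N:
  assumes "A \<subseteq> N v"
  shows "(\<Sum>s\<in>A. card (N s)) = card A + edge_count A (N v) + edge_count A (far v)"
proof -
  have "(\<Sum>s\<in>A. card (N s)) = (\<Sum>s\<in>A. 1 + deg_in (N v) s + deg_in (far v) s)"
    using assms by (intro sum.cong refl card_N_split) auto
  thus ?thesis by (simp add: edge_count_def sum.distrib sum_Suc)
qed

lemma missing_ge_two:
  assumes "t \<in> far v" "u \<in> far v" "t \<noteq> u"
  shows "card (N v - N t) + card (N v - N u) \<le> missing v"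
  using sum_mono2[of "far v" "{t, u}" "\<lambda>t. card (N v - N t)"] assms by (simp add: missing_def)

lemma missing_ge: "t \<in> far v \<Longrightarrow> card (N v - N t) \<le> missing v"
  unfolding missing_def by (rule member_le_sum) auto

end

section \<open>Graphs without the chorded cycle\<close>

lemma is_cycle_Cons:
  assumes "distinct (w # p)" "length p \<ge> 2" "successively (\<lambda>x y. {x, y} \<in> E) p"
    and ends: "{w, hd p} \<in> E" "{w, last p} \<in> E"
  shows "is_cycle E (w # p)"
  unfolding is_cycle_def
proof (intro conjI allI impI)
  let ?cs = "w # p"
  have nonempty: "p \<noteq> []" using assms(2) by auto
  fix i assume i: "i < length ?cs"
  show "{?cs ! i, ?cs ! ((i + 1) mod length ?cs)} \<in> E"
  proof (cases i)
    case 0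
    thus ?thesis using ends(1) nonempty by (simp add: hd_conv_nth)
  next
    case (Suc j)
    show ?thesis
    proof (cases "Suc j < length p")
      case True
      thus ?thesis using assms(3) Suc by (simp add: successively_conv_nth)
    next
      case False
      hence "length p = Suc j" using Suc i by simp
      thus ?thesis using Suc ends(2) nonempty by (simp add: last_conv_nth insert_commute)
    qed
  qed
qed (use assms in auto)

lemma cycle_consecutive_Cons:
  assumes "distinct (w # p)" "p \<noteq> []" "cycle_consecutive (w # p) w x"
  shows "x = hd p \<or> x = last p"
proof -
  obtain i where i: "i < length (w # p)" "{(w # p) ! i, (w # p) ! ((i + 1) mod length (w # p))} = {w, x}"
    using assms(3) unfolding cycle_consecutive_def by blast
  show ?thesis
  proof (cases i)
    case 0
    thus ?thesis using i assms(1,2) by (auto simp: doubleton_eq_iff hd_conv_nth)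
  next
    case (Suc j)
    hence "p ! j \<in> set p" using i(1) by simp
    show ?thesis
    proof (cases "Suc j < length p")
      case True
      hence "{p ! j, p ! Suc j} = {w, x}" "p ! Suc j \<in> set p" using i Suc by auto
      thus ?thesis using assms(1) \<open>p ! j \<in> set p\<close> by (auto simp: doubleton_eq_iff)
    next
      case False
      hence "length p = Suc j" using Suc i(1) by simp
      thus ?thesis using i(2) Suc assms(2) \<open>p ! j \<in> set p\<close> assms(1)
        by (auto simp: doubleton_eq_iff last_conv_nth)
    qed
  qed
qed

lemma hub_cycle_has_three_chords:
  assumes "distinct (w # p)" "successively (\<lambda>x y. {x, y} \<in> E) p"
    and ends: "{w, hd p} \<in> E" "{w, last p} \<in> E"
    and nbrs: "5 \<le> card {x \<in> set p. {w, x} \<in> E}"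
  shows "has_trebly_chorded_cycle_at_vertex E"
proof -
  let ?X = "{x \<in> set p. {w, x} \<in> E}"
  have "card ?X \<le> length p" using card_mono[of "set p" ?X] card_length[of p] by simp
  hence len: "2 \<le> length p" "p \<noteq> []" using nbrs by auto
  have cyc: "is_cycle E (w # p)" by (rule is_cycle_Cons[OF assms(1) len(1) assms(2) ends])
  have "card ?X - card {hd p, last p} \<le> card (?X - {hd p, last p})"
    by (rule diff_card_le_card_Diff) simp
  moreover have "card {hd p, last p} \<le> 2" by (simp add: card_insert_if)
  ultimately have "3 \<le> card (?X - {hd p, last p})" using nbrs by linarith
  then obtain x1 x2 x3 where x: "{x1, x2, x3} \<subseteq> ?X - {hd p, last p}" "distinct [x1, x2, x3]"
    by (elim card_ge_3E) auto
  have chord: "is_chord E (w # p) {w, x}" if "x \<in> ?X - {hd p, last p}" for x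
  proof -
    have "{w, x} \<in> E" "x \<in> set (w # p)" "w \<noteq> x" "\<not> cycle_consecutive (w # p) w x"
      using that assms(1) cycle_consecutive_Cons[OF assms(1) len(2)] by auto
    thus ?thesis unfolding is_chord_def by (metis list.set_intros(1))
  qed
  show ?thesis
    unfolding has_trebly_chorded_cycle_at_vertex_def
  proof (intro exI conjI)
    show "is_cycle E (w # p)" by (rule cyc)
    show "is_chord E (w # p) {w, x1}" "is_chord E (w # p) {w, x2}" "is_chord E (w # p) {w, x3}"
      using chord x(1) by simp_all
  qed (use x(2) in \<open>auto simp: doubleton_eq_iff\<close>)
qed

lemma card_less_imp_outside:
  assumes "finite A" "card A < card B"
  obtains u where "u \<in> B" "u \<notin> A"
  using assms by (metis card_mono not_le subsetI)

locale tcc_free = fin_graph +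
  assumes tcc_free: "\<not> has_trebly_chorded_cycle_at_vertex E"
begin

lemma hub_path_card_le_4:
  assumes "distinct (w # p)" "successively adj p" "hd p \<in> N w" "last p \<in> N w"
  shows "card (set p \<inter> N w) \<le> 4"
proof (rule ccontr)
  assume "\<not> ?thesis"
  hence "5 \<le> card {x \<in> set p. {w, x} \<in> E}" by (simp add: N_def adjacent_def Collect_conj_eq)
  moreover have "successively (\<lambda>x y. {x, y} \<in> E) p"
    using assms(2) by (simp add: adjacent_def[abs_def])
  ultimately show False
    using hub_cycle_has_three_chords[of w p E] assms tcc_free by (simp add: adjacent_def)
qed

lemma path5_free_N: "path5_free (N w)"
  unfolding path5_free_def
proof (intro allI impI notI)
  fix a b c d e
  assume p: "{a, b, c, d, e} \<subseteq> N w \<and> distinct [a, b, c, d, e] \<and> adj a b \<and> adj b c \<and> adj c d" "adj d e"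
  have "distinct [w, a, b, c, d, e]" using p by auto
  hence "card (set [a, b, c, d, e] \<inter> N w) \<le> 4" using p by (intro hub_path_card_le_4) auto
  moreover have "set [a, b, c, d, e] \<inter> N w = {a, b, c, d, e}" using p by auto
  ultimately show False using p by simp
qed

lemma no_P4_attached:
  assumes "t \<in> far v" "{a, b, c, d, u} \<subseteq> N v" "distinct [a, b, c, d, u]"
    and "adj a b" "adj b c" "adj c d" "adj t d" "adj t u"
  shows False
proof -
  have "distinct [v, a, b, c, d, t, u]" using assms by (auto simp: far_iff)
  hence "card (set [a, b, c, d, t, u] \<inter> N v) \<le> 4"
    using assms by (intro hub_path_card_le_4) (auto simp: adj_commute)
  moreover have "set [a, b, c, d, t, u] \<inter> N v = {a, b, c, d, u}" using assms by (auto simp: far_iff)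
  ultimately show False using assms(3) by simp
qed

lemma no_P3_P2_attached:
  assumes "t \<in> far v" "{a, b, c, x, y} \<subseteq> N v" "distinct [a, b, c, x, y]"
    and "adj a b" "adj b c" "adj x y" "adj t a" "adj t x"
  shows False
proof -
  have "distinct [v, c, b, a, t, x, y]" using assms by (auto simp: far_iff)
  hence "card (set [c, b, a, t, x, y] \<inter> N v) \<le> 4"
    using assms by (intro hub_path_card_le_4) (auto simp: adj_commute)
  moreover have "set [c, b, a, t, x, y] \<inter> N v = {c, b, a, x, y}" using assms by (auto simp: far_iff)
  moreover have "distinct [c, b, a, x, y]" using assms(3) by auto
  ultimately show False by simp
qed

lemma no_claw_attached:
  assumes "t \<in> far v" "{w, x, y, z} \<subseteq> N v" "distinct [x, y, z]"
    and "adj w x" "adj w y" "adj w z" "adj t w" "adj t y" "adj t z"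
  shows False
proof -
  have "distinct [x, v, y, t, z]" using assms by (auto simp: far_iff)
  thus False using path5_freeD[OF path5_free_N, of x v y t z w] assms by (auto simp: adj_commute)
qed

lemma no_P3_doubly_attached:
  assumes "t \<in> far v" "u \<in> far v" "t \<noteq> u" "{p, q, r} \<subseteq> N v" "q \<noteq> r"
    and "adj p q" "adj p r" "adj t p" "adj u p" "adj t q" "adj u r"
  shows False
proof -
  have "distinct [t, q, v, r, u]" using assms by (auto simp: far_iff)
  thus False using path5_freeD[OF path5_free_N, of t q v r u p] assms by (auto simp: adj_commute)
qed

lemma four_cycle_attached:
  assumes Q: "spans_four_cycle Q" "Q \<subseteq> N v" and t: "t \<in> far v" "p \<in> Q" "adj t p"
  shows "N t \<inter> N v \<subseteq> Q"
proof (rule subsetI, rule ccontr)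
  fix u assume u: "u \<in> N t \<inter> N v" "u \<notin> Q"
  obtain q r s where "Q = {p, q, r, s}" "four_cycle p q r s" using four_cycle_from[OF Q(1) t(2)] .
  thus False
    using no_P4_attached[OF t(1), of q r s p u] Q(2) t(3) u by (auto simp: four_cycle_def)
qed

lemma universal_attached:
  assumes Q: "spans_four_cycle Q" "Q \<subseteq> N v" and t: "t \<in> far v" "adj t p"
    and p: "p \<in> Q" "Q - {p} \<subseteq> N p"
  shows "N t \<inter> Q \<subseteq> {p}"
proof (rule subsetI, rule ccontr)
  fix s assume s: "s \<in> N t \<inter> Q" "s \<notin> {p}"
  hence "s \<in> Q" by simp
  then obtain a b c where Q_eq: "Q = {s, a, b, c}" and cycle: "four_cycle s a b c"
    using four_cycle_from[OF Q(1)] by blast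
  obtain x y where xy: "x \<in> Q - {p, s}" "y \<in> Q - {p, s}" "x \<noteq> y" "adj s x"
  proof -
    have distinct: "distinct [s, a, b, c]" and nbrs: "adj s a" "adj s c"
      using cycle by (simp_all add: four_cycle_def adj_commute)
    consider "p = a" | "p = b" | "p = c" using p(1) s(2) Q_eq by blast
    thus ?thesis
    proof cases
      case 1 show ?thesis by (rule that[of c b]) (use 1 distinct nbrs Q_eq in auto)
    next
      case 2 show ?thesis by (rule that[of a c]) (use 2 distinct nbrs Q_eq in auto)
    next
      case 3 show ?thesis by (rule that[of a b]) (use 3 distinct nbrs Q_eq in auto)
    qed
  qed
  hence "adj v p" "adj v x" "adj v y" using Q(2) p(1) by auto
  moreover have "adj p s" "adj p x" "adj p y" using p(2) xy(1,2) s by auto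
  moreover have "t \<notin> Q" "v \<notin> Q" using t(1) Q(2) by (auto simp: far_iff)
  ultimately show False
    using path5_freeD[OF path5_free_N, of t s x v y p] t s xy by (auto simp: far_iff adj_commute)
qed

lemma diamond_attached_le_2:
  assumes Q: "diamond Q" "Q \<subseteq> N v" and t: "t \<in> far v"
  shows "deg_in Q t \<le> 2"
proof -
  obtain p q r s where Q_eq: "Q = {p, q, r, s}" and cycle: "four_cycle p q r s" "adj p r"
    using Q(1) unfolding diamond_def by blast
  have universal: "Q - {x} \<subseteq> N x" "x \<in> Q" if "x \<in> {p, r}" for x
    using cycle that by (auto simp: Q_eq four_cycle_def adj_commute)
  have "\<exists>x y. N t \<inter> Q \<subseteq> {x, y}"
  proof (cases "adj t p \<or> adj t r")
    case True
    then obtain x where x: "x \<in> {p, r}" "adj t x" by blast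
    have "N t \<inter> Q \<subseteq> {x}"
      by (rule universal_attached[OF diamond_spans_four_cycle[OF Q(1)] Q(2) t x(2)])
        (rule universal[OF x(1)])+
    thus ?thesis by blast
  next
    case False
    hence "N t \<inter> Q \<subseteq> {q, s}" by (auto simp: Q_eq)
    thus ?thesis by blast
  qed
  then obtain x y where "N t \<inter> Q \<subseteq> {x, y}" by blast
  from card_mono[OF _ this] show ?thesis by (auto simp: card_insert_if split: if_splits)
qed

lemma clique_attached_le_1:
  assumes Q: "diamond Q" "Q \<subseteq> N v" "clique Q" and t: "t \<in> far v"
  shows "deg_in Q t \<le> 1"
proof (cases "N t \<inter> Q = {}")
  case False
  then obtain p where p: "p \<in> Q" "adj t p" by auto
  have "Q - {p} \<subseteq> N p" unfolding N_def using cliqueD[OF Q(3) p(1)] by blast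
  hence "N t \<inter> Q \<subseteq> {p}"
    by (rule universal_attached[OF diamond_spans_four_cycle[OF Q(1)] Q(2) t p(2,1)])
  from card_mono[OF _ this] show ?thesis by simp
qed simp

lemma diamond_attached_count:
  assumes "diamond Q" "Q \<subseteq> N v" "t \<in> far v"
  shows "edge_count Q Q + 2 * deg_in Q t \<le> 14"
  using diamond_attached_le_2[OF assms] clique_attached_le_1[OF assms(1,2) _ assms(3)]
    diamond_edge_count_le[OF assms(1)] diamond_edge_count_nonclique[OF assms(1)] by fastforce

lemma diamond_missing:
  assumes Q: "diamond Q" "Q \<subseteq> N v" and t: "t \<in> far v" and "5 \<le> card (N v)"
  shows "edge_count Q Q \<le> 2 * card (N v - N t) + 4"
proof (cases "N t \<inter> Q = {}")
  case True
  hence "card Q \<le> card (N v - N t)" using Q(2) by (intro card_mono) auto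
  thus ?thesis using diamond_card[OF Q(1)] diamond_edge_count_le[OF Q(1)] by simp
next
  case False
  then obtain p where "p \<in> Q" "adj t p" by auto
  hence "N t \<inter> N v \<subseteq> Q" by (rule four_cycle_attached[OF diamond_spans_four_cycle[OF Q(1)] Q(2) t])
  hence "N t \<inter> N v = N t \<inter> Q" using Q(2) by auto
  thus ?thesis using diamond_attached_count[OF Q t] card_N_Int_Diff[of t v] assms(4) by simp
qed

lemma diamonds_missing:
  assumes "t \<in> far v"
  shows "card (diamonds (N v)) \<le> card (N v - N t) + 2"
proof (cases "N t \<inter> diamonds (N v) = {}")
  case True
  hence "card (diamonds (N v)) \<le> card (N v - N t)" using diamonds_subset by (intro card_mono) auto
  thus ?thesis by simp
next
  case False
  then obtain p where p: "p \<in> diamonds (N v)" "adj t p" by auto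
  then obtain Q where Q: "Q \<subseteq> N v" "diamond Q" "p \<in> Q" by (elim in_diamondsE)
  have "N t \<inter> N v \<subseteq> Q"
    by (rule four_cycle_attached[OF diamond_spans_four_cycle[OF Q(2)] Q(1) assms Q(3) p(2)])
  hence "N t \<inter> N v = N t \<inter> Q" using Q(1) by auto
  hence "card (N v) \<le> card (N v - N t) + 2"
    using diamond_attached_le_2[OF Q(2,1) assms] card_N_Int_Diff[of t v] by simp
  moreover have "card (diamonds (N v)) \<le> card (N v)" by (intro card_mono diamonds_subset) simp
  ultimately show ?thesis by simp
qed

lemma single_diamond_edge_count:
  assumes "diamonds (N v) = Q" "diamond Q"
  shows "edge_count (N v) (N v) + 8 \<le> 2 * card (N v) + edge_count Q Q"
proof -
  have "closed_in (N v) Q" using diamonds_closed[OF path5_free_N] assms(1) by blast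
  thus ?thesis
    using edge_count_closed_split[OF finite_N, of v Q] closed_in_card_Diff[OF finite_N, of v Q]
      edge_count_off_diamonds[OF finite_N path5_free_N, of v] diamond_card[OF assms(2)]
    by (simp add: assms(1))
qed

lemma diamond_two_far_sparse:
  assumes Q: "diamond Q" "Q \<subseteq> N v"
    and tu: "t \<in> far v" "u \<in> far v" "t \<noteq> u" and degree: "5 \<le> card (N v)"
  shows "edge_count (N v) (N v) + 3 \<le> 2 * card (N v) + missing v"
proof -
  have "diamonds (N v) = Q \<or> 8 \<le> card (diamonds (N v))"
    by (rule diamonds_eq_or_card_ge_8[OF path5_free_N finite_N Q(2,1)])
  thus ?thesis
  proof
    assume "diamonds (N v) = Q"
    thus ?thesis
      using single_diamond_edge_count[OF _ Q(1), of v] diamond_missing[OF Q tu(1) degree]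
        diamond_missing[OF Q tu(2) degree] missing_ge_two[OF tu] by linarith
  next
    assume "8 \<le> card (diamonds (N v))"
    thus ?thesis
      using edge_count_le_diamonds[OF finite_N path5_free_N, of v] diamonds_missing[OF tu(1)]
        diamonds_missing[OF tu(2)] missing_ge_two[OF tu] by simp
  qed
qed

lemma diamond_low_degree_sparse:
  assumes Q: "diamond Q" "Q \<subseteq> N v"
    and tu: "t \<in> far v" "u \<in> far v" "t \<noteq> u" and degree: "card (N v) \<le> 4"
  shows "edge_count (N v) (N v) + 1 < 2 * card (N v) + missing v"
proof -
  have "N v = Q" using card_seteq[OF finite_N Q(2)] degree diamond_card[OF Q(1)] by simp
  thus ?thesis
    using diamond_attached_count[OF Q tu(1)] diamond_attached_count[OF Q tu(2)] missing_ge_two[OF tu]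
      card_N_Int_Diff[of t v] card_N_Int_Diff[of u v] diamond_card[OF Q(1)] by simp
qed

lemma diamond_free_two_far_sparse:
  assumes df: "diamond_free (N v)" and "N v \<noteq> {}" and tu: "t \<in> far v" "u \<in> far v" "t \<noteq> u"
  shows "edge_count (N v) (N v) + 1 < 2 * card (N v) + missing v"
proof (rule ccontr)
  assume dense: "\<not> ?thesis"
  moreover have "edge_count (N v) (N v) \<le> 2 * card (N v)"
    by (rule edge_count_le_twice_card[OF finite_N path5_free_N df])
  ultimately have few: "card (N v - N t) + card (N v - N u) \<le> 1"
    using missing_ge_two[OF tu] by linarith
  have "2 * card (N v) \<le> edge_count (N v) (N v) + 1" using dense by linarith
  then obtain V where V: "V \<subseteq> N v" "V \<noteq> {}" "\<forall>s\<in>V. 2 \<le> deg_in V s"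
    using min_degree_2_core[OF finite_N assms(2)] by metis
  have "card ((N v - N t) \<union> (N v - N u)) \<le> 1"
    using card_Un_le[of "N v - N t" "N v - N u"] few by linarith
  moreover have "1 < card V"
  proof -
    obtain s where "s \<in> V" "2 \<le> deg_in V s" using V(2,3) by blast
    thus ?thesis using deg_in_less_card[of V s] finite_subset[OF V(1)] by simp
  qed
  ultimately obtain p where p: "p \<in> V" "p \<notin> (N v - N t) \<union> (N v - N u)"
    using card_less_imp_outside[of "(N v - N t) \<union> (N v - N u)" V] by auto
  then obtain q r where qr: "q \<in> V" "r \<in> V" "adj p q" "adj p r" "q \<noteq> r"
    using V(3) by (auto elim!: card_ge_2E)
  have S: "p \<in> N v" "q \<in> N v" "r \<in> N v" using V(1) p(1) qr(1,2) by blast+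
  have full_at_p: "adj t p" "adj u p" using p S(1) by auto
  have "card (N v - N t) = 0 \<or> card (N v - N u) = 0" using few by linarith
  hence "N v \<subseteq> N t \<or> N v \<subseteq> N u" by simp
  moreover have "adj x q \<or> adj x r" if "x \<in> {t, u}" for x
  proof (rule ccontr)
    assume "\<not> ?thesis"
    hence "{q, r} \<subseteq> N v - N x" using S by auto
    from card_mono[OF _ this] show False using few qr(5) that by auto
  qed
  ultimately have "(adj t q \<and> adj u r) \<or> (adj t r \<and> adj u q)" using S by auto
  thus False
    using no_P3_doubly_attached[OF tu, of p q r] no_P3_doubly_attached[OF tu, of p r q] S full_at_p qr
    by auto
qed

lemma triangle_pendants_not_both_attached:
  assumes T: "T \<subseteq> N v" "clique T" "card T = 3" and ab: "a \<in> T" "b \<in> T - {a}" "adj t b"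
    and x: "x \<in> N a \<inter> N v - T" "x' \<in> N a \<inter> N v - T" "x' \<noteq> x" and t: "t \<in> far v"
  shows "\<not> adj t x"
proof
  assume tx: "adj t x"
  obtain c where c: "c \<in> T" "c \<noteq> a" "c \<noteq> b"
    using triangleE[OF T(2,3) ab(1)] ab(2) by (metis distinct_length_2_or_more insertCI)
  have "adj x' a" "adj a c" "adj c b" using cliqueD[OF T(2)] ab c x(2) by (auto simp: adj_commute)
  moreover have "{x', a, c, b, x} \<subseteq> N v" "distinct [x', a, c, b, x]" using T(1) ab c x by auto
  ultimately show False using no_P4_attached[OF t] ab(3) tx by metis
qed

lemma triangle_two_pendants_missing:
  assumes T: "T \<subseteq> N v" "clique T" "card T = 3" and a: "a \<in> T"
    and x: "x1 \<in> N a \<inter> N v - T" "x2 \<in> N a \<inter> N v - T" "x1 \<noteq> x2" and t: "t \<in> far v"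
  shows "3 \<le> card (N v - N t)"
proof (rule ccontr)
  assume few: "\<not> ?thesis"
  obtain b c where bc: "T = {a, b, c}" "distinct [a, b, c]" "adj a b" "adj a c" "adj b c"
    using triangleE[OF T(2,3) a] .
  have S: "{a, b, c, x1, x2} \<subseteq> N v" and distinct: "distinct [a, b, c, x1, x2]"
    using T(1) bc(1,2) x by auto
  have attached: "adj t s" if "{y, z} \<subseteq> N v - N t" "y \<noteq> z" "s \<in> N v" "s \<notin> {y, z}" for s y z
  proof (rule ccontr)
    assume "\<not> adj t s"
    hence "{s, y, z} \<subseteq> N v - N t" using that by auto
    from card_mono[OF _ this] show False using few that(2,4) by simp
  qed
  show False
  proof (cases "adj t b \<or> adj t c")
    case True
    then obtain z where z: "z \<in> T - {a}" "adj t z" using bc(1,2) by auto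
    have "\<not> adj t x1" "\<not> adj t x2"
      using triangle_pendants_not_both_attached[OF T a z _ _ _ t] x by blast+
    hence "{x1, x2} \<subseteq> N v - N t" using S by auto
    note attached = attached[OF this x(3)]
    have "adj t a" "adj t b" "adj t c" by (rule attached; use S distinct in auto)+
    thus False using no_claw_attached[OF t, of a x1 b c] S distinct bc x by auto
  next
    case False
    hence "{b, c} \<subseteq> N v - N t" using S by auto
    note attached = attached[OF this]
    have "adj t a" "adj t x1" "adj t x2" by (rule attached; use S distinct in auto)+
    thus False using no_claw_attached[OF t, of a b x1 x2] S distinct bc x by auto
  qed
qed

lemma triangle_cyclic_rest_missing:
  assumes T: "T \<subseteq> N v" "clique T" "card T = 3"
    and R: "R \<subseteq> N v - T" "R \<noteq> {}" "2 * card R \<le> edge_count R R + 1" and t: "t \<in> far v"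
  shows "3 \<le> card (N v - N t)"
proof (rule ccontr)
  assume few: "\<not> ?thesis"
  have "finite R" by (rule finite_subset[OF R(1)]) simp
  then obtain V where V: "V \<subseteq> R" "V \<noteq> {}" "\<forall>s\<in>V. 2 \<le> deg_in V s"
    using min_degree_2_core[OF _ R(2,3)] by metis
  obtain p where p: "p \<in> T" "p \<notin> N v - N t"
    using card_less_imp_outside[of "N v - N t" T] few T(3) by auto
  obtain q r where pqr: "T = {p, q, r}" "distinct [p, q, r]" "adj p q" "adj p r" "adj q r"
    using triangleE[OF T(2,3) p(1)] .
  have "V \<subseteq> N v - N t"
  proof
    fix x assume x: "x \<in> V"
    then obtain y where y: "y \<in> V" "adj x y" using V(3) by (metis second_neighbour)
    have xy: "x \<in> N v - T" "y \<in> N v - T" "x \<noteq> y" using x y V(1) R(1) by auto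
    hence "\<not> adj t x" using no_P3_P2_attached[OF t, of p q r x y] y(2) p T(1) pqr by auto
    thus "x \<in> N v - N t" using xy(1) by simp
  qed
  hence "card V \<le> 2" using card_mono[of "N v - N t" V] few by simp
  obtain s where s: "s \<in> V" "2 \<le> deg_in V s" using V(2,3) by blast
  have "finite V" by (rule finite_subset[OF V(1) \<open>finite R\<close>])
  thus False using deg_in_less_card[of V s] s \<open>card V \<le> 2\<close> by simp
qed

context
  fixes v t :: nat
  assumes t: "t \<in> far v" and degree: "5 \<le> card (N v)" and df: "diamond_free (N v)"
begin

lemma fully_attached_P3_closed:
  assumes full: "N v \<subseteq> N t" and b: "b \<in> N v" "N b \<inter> N v = {a, c}" "a \<noteq> c"
  shows "closed_in (N v) {a, b, c}"
proof (rule closed_inI)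
  have ac: "a \<in> N b \<inter> N v" "c \<in> N b \<inter> N v" using b(2) by simp_all
  have distinct: "distinct [a, b, c]" using ac b(3) by auto
  show "{a, b, c} \<subseteq> N v" using ac b(1) by simp
  fix y x assume y: "y \<in> {a, b, c}" and x: "x \<in> N v" "adj y x"
  show "x \<in> {a, b, c}"
  proof (rule ccontr)
    assume outside: "x \<notin> {a, b, c}"
    have "y \<noteq> b"
    proof
      assume "y = b"
      hence "x \<in> N b \<inter> N v" using x by simp
      thus False using outside unfolding b(2) by simp
    qed
    then obtain z where z: "{y, z} = {a, c}" "y \<noteq> z" using y b(3) by blast
    hence yz: "y \<in> N b \<inter> N v" "z \<in> N b \<inter> N v" "distinct [x, y, b, z]"
      using ac outside distinct by (auto simp: doubleton_eq_iff)
    have "card {x, y, b, z} < card (N v)" using degree by (simp add: card_insert_if)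
    then obtain u where u: "u \<in> N v" "u \<notin> {x, y, b, z}"
      using card_less_imp_outside[of "{x, y, b, z}" "N v"] by auto
    have "adj t z" "adj t u" using full yz(2) u(1) by auto
    thus False using no_P4_attached[OF t, of x y b z u] x b(1) yz u by (auto simp: adj_commute)
  qed
qed

lemma fully_attached_degree_le_2:
  assumes full: "N v \<subseteq> N t" and s: "s \<in> N v"
  shows "deg_in (N v) s \<le> 2"
proof (rule ccontr)
  assume "\<not> ?thesis"
  hence "3 \<le> deg_in (N v) s" by simp
  then obtain x y z where "x \<in> N s \<inter> N v" "y \<in> N s \<inter> N v" "z \<in> N s \<inter> N v" "x \<noteq> y" "x \<noteq> z" "y \<noteq> z"
    by (rule card_ge_3E)
  moreover from this have "adj t s" "adj t y" "adj t z" using full s by auto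
  ultimately show False using no_claw_attached[OF t, of s x y z] s by auto
qed

lemma fully_attached_sparse:
  assumes full: "N v \<subseteq> N t"
  shows "edge_count (N v) (N v) + 2 < 2 * card (N v)"
proof (cases "\<exists>b\<in>N v. 2 \<le> deg_in (N v) b")
  case True
  note le_2 = fully_attached_degree_le_2[OF full]
  obtain b where b: "b \<in> N v" "2 \<le> deg_in (N v) b" using True by blast
  hence "card (N b \<inter> N v) = 2" using le_2[OF b(1)] by simp
  then obtain a c where ac: "N b \<inter> N v = {a, c}" "a \<noteq> c" by (auto simp: card_2_iff)
  let ?P = "{a, b, c}"
  have closed: "closed_in (N v) ?P" by (rule fully_attached_P3_closed[OF full b(1) ac])
  have ac_S: "a \<in> N b \<inter> N v" "c \<in> N b \<inter> N v" using ac(1) by simp_all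
  have "distinct [a, b, c]" using ac_S ac(2) by auto
  hence "card ?P = 3" by simp
  moreover have "edge_count ?P ?P \<le> card ?P * 2"
    unfolding closed_in_edge_count[OF closed, symmetric]
    using le_2 closed_in_subset[OF closed] by (intro edge_count_le) blast
  moreover have "edge_count (N v - ?P) (N v - ?P) = 0"
  proof (rule ccontr)
    assume "edge_count (N v - ?P) (N v - ?P) \<noteq> 0"
    then obtain x where x: "x \<in> N v - ?P" "deg_in (N v - ?P) x \<noteq> 0"
      unfolding edge_count_def by (meson sum.neutral)
    hence "N x \<inter> (N v - ?P) \<noteq> {}" by (metis card.empty)
    then obtain y where "y \<in> N x \<inter> (N v - ?P)" by blast
    hence y: "y \<in> N v - ?P" "adj x y" by simp_all
    have "adj t a" "adj t x" using full ac_S(1) x(1) by auto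
    moreover have "x \<noteq> y" using y(2) by auto
    hence "distinct [a, b, c, x, y]" using \<open>distinct [a, b, c]\<close> x(1) y(1) by auto
    ultimately show False
      using no_P3_P2_attached[OF t, of a b c x y] x(1) y ac_S b(1) by (simp add: adj_commute)
  qed
  ultimately show ?thesis using edge_count_closed_split[OF finite_N closed] degree by simp
next
  case False
  hence "edge_count (N v) (N v) \<le> card (N v) * 1" by (intro edge_count_le) force
  thus ?thesis using degree by simp
qed

lemma four_cycle_sparse:
  assumes few: "card (N v - N t) \<le> 2" and Q: "Q \<subseteq> N v" "spans_four_cycle Q"
  shows "edge_count (N v) (N v) + 1 < 2 * card (N v)"
proof -
  let ?R = "N v - Q"
  have closed: "closed_in (N v) Q" by (rule spans_four_cycle_closed[OF path5_free_N Q(2,1)])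
  have card_Q: "card Q = 4" by (rule spans_four_cycle_card[OF Q(2)])
  obtain p where p: "p \<in> Q" "p \<notin> N v - N t"
    using card_less_imp_outside[of "N v - N t" Q] few card_Q by auto
  hence "N t \<inter> N v \<subseteq> Q" using four_cycle_attached[OF Q(2,1) t] Q(1) by auto
  hence "?R \<subseteq> N v - N t" by auto
  hence "card ?R \<le> 2" using card_mono[of "N v - N t" ?R] few by simp
  moreover have card: "card (N v) = 4 + card ?R"
    using closed_in_card_Diff[OF finite_N closed] card_Q by simp
  ultimately have R: "card ?R = 1 \<or> card ?R = 2" using degree by linarith
  have "edge_count ?R ?R \<le> card ?R * (card ?R - 1)" by (intro edge_count_le_complete) simp
  moreover have "edge_count Q Q \<le> 8"
    using diamond_free_edge_count_four_cycle[OF diamond_free_subset[OF df Q(1)] Q(2)] .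
  ultimately show ?thesis using edge_count_closed_split[OF finite_N closed] card R by auto
qed

lemma triangle_sparse:
  assumes few: "card (N v - N t) \<le> 2" and T: "T \<subseteq> N v" "clique T" "card T = 3"
  shows "edge_count (N v) (N v) + 1 < 2 * card (N v)"
proof (rule ccontr)
  assume dense: "\<not> ?thesis"
  obtain a where pendant: "pendant_triangle (N v) T a"
    using triangle_is_pendant[OF path5_free_N df T] .
  hence a: "a \<in> T" by (simp add: pendant_triangle_def)
  let ?Q = "T \<union> (N a \<inter> N v)"
  let ?R = "N v - ?Q"
  note closed = pendant_triangle_closed[OF path5_free_N pendant]
  have R_sum: "2 * card ?R \<le> edge_count ?R ?R + 1"
    using dense pendant_triangle_edge_count[OF finite_N path5_free_N pendant]
      edge_count_closed_split[OF finite_N closed] closed_in_card_Diff[OF finite_N closed] by simp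
  have "?R = {}"
  proof (rule ccontr)
    assume "?R \<noteq> {}"
    hence "3 \<le> card (N v - N t)" by (intro triangle_cyclic_rest_missing[OF T _ _ R_sum t]) auto
    thus False using few by simp
  qed
  hence "N v \<subseteq> T \<union> (N a \<inter> N v - T)" by auto
  moreover have "finite T" using T(3) card_ge_0_finite by force
  ultimately have "card (N v) \<le> card (T \<union> (N a \<inter> N v - T))" by (intro card_mono) auto
  also have "\<dots> \<le> 3 + card (N a \<inter> N v - T)" using card_Un_le[of T "N a \<inter> N v - T"] T(3) by simp
  finally have "card (N v) \<le> 3 + card (N a \<inter> N v - T)" .
  hence "2 \<le> card (N a \<inter> N v - T)" using degree by simp
  then obtain x1 x2 where "x1 \<in> N a \<inter> N v - T" "x2 \<in> N a \<inter> N v - T" "x1 \<noteq> x2" by (rule card_ge_2E)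
  thus False using triangle_two_pendants_missing[OF T a _ _ _ t] few by fastforce
qed

lemma diamond_free_one_far_sparse:
  "edge_count (N v) (N v) + 2 < 2 * card (N v) + card (N v - N t)"
proof (rule ccontr)
  assume dense: "\<not> ?thesis"
  have "edge_count (N v) (N v) \<le> 2 * card (N v)"
    by (rule edge_count_le_twice_card[OF finite_N path5_free_N df])
  hence few: "card (N v - N t) \<le> 2" using dense by linarith
  have "\<not> N v \<subseteq> N t" using fully_attached_sparse dense by force
  hence "card (N v - N t) \<noteq> 0" by auto
  hence cyclic: "2 * card (N v) \<le> edge_count (N v) (N v) + 1" using dense by linarith
  have "N v \<noteq> {}" using degree by auto
  from finite_N path5_free_N this cyclic show False
  proof (cases rule: dense_has_short_cycle)
    case (triangle T)
    thus False using triangle_sparse[OF few] cyclic by fastforce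
  next
    case (square Q)
    thus False using four_cycle_sparse[OF few] cyclic by fastforce
  qed
qed

end

end

section \<open>Subsolutions\<close>

text \<open>The vertex \<open>v\<close> maximises \<open>y u / (deg u - \<alpha>)\<close>. The choice \<open>\<alpha> = 0\<close> yields the classical
  bound by \<open>deg v\<close> plus the average degree of its neighbours; the small shift \<open>\<alpha>\<close> used below
  sharpens it just enough to leave only configurations with few missing edges.\<close>
locale subsolution = fin_graph +
  fixes \<mu> \<alpha> :: real and v :: nat and y :: "nat \<Rightarrow> real"
  assumes v_less: "v < n" and deg_pos: "1 \<le> card (N v)" and shift: "0 \<le> \<alpha>" "\<alpha> < 1"
    and y_v: "y v = card (N v) - \<alpha>"
    and y_le: "\<And>u. u < n \<Longrightarrow> y u \<le> card (N u) - \<alpha>"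
    and y_nonneg: "\<And>u. 0 \<le> y u"
    and y_sub: "\<And>u. u < n \<Longrightarrow> (\<mu> - card (N u)) * y u \<le> (\<Sum>w\<in>N u. y w)"
begin

lemma y_v_pos: "0 < y v"
  using y_v deg_pos shift by linarith

lemma sum_y_le:
  assumes "B \<subseteq> N v"
  shows "(\<Sum>s\<in>B. y s) \<le> real (card B + edge_count B (N v) + edge_count B (far v)) - \<alpha> * card B"
proof -
  have "(\<Sum>s\<in>B. y s) \<le> (\<Sum>s\<in>B. real (card (N s)) - \<alpha>)"
    using assms adj_less by (intro sum_mono y_le) auto
  also have "\<dots> = real (\<Sum>s\<in>B. card (N s)) - \<alpha> * card B" by (simp add: sum_subtractf)
  finally show ?thesis unfolding sum_card_N[OF assms] .
qed

lemma first_order: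
  "(\<mu> - n) * card (N v) + missing v \<le> edge_count (N v) (N v) + \<alpha> * (\<mu> - 2 * card (N v))"
proof -
  let ?d = "real (card (N v))"
  have "(\<mu> - ?d) * (?d - \<alpha>) \<le> (\<Sum>w\<in>N v. y w)" using y_sub[OF v_less] by (simp add: y_v)
  also have "\<dots> \<le> ?d + edge_count (N v) (N v) + edge_count (N v) (far v) - \<alpha> * ?d"
    using sum_y_le[of "N v"] by simp
  also have "real (edge_count (N v) (far v)) = (real n - 1 - ?d) * ?d - missing v"
  proof -
    have "real (edge_count (N v) (far v)) + missing v = card (far v) * ?d"
      using edge_count_far[of v] by (simp flip: of_nat_add of_nat_mult)
    moreover have "real (card (far v)) = real n - 1 - ?d" using card_far[OF v_less] by simp
    ultimately show ?thesis by simp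
  qed
  finally show ?thesis by (simp add: algebra_simps)
qed

lemma closed_part_bound:
  assumes H: "closed_in (N v) H" "\<And>s. s \<in> H \<Longrightarrow> N s \<inter> far v = {}" "\<And>s. s \<in> H \<Longrightarrow> deg_in (N v) s \<le> k"
    and large: "2 * real k + 1 < \<mu>" and s: "s \<in> H"
  shows "y s \<le> y v / (\<mu> - 2 * real k - 1)"
proof -
  have HN: "H \<subseteq> N v" by (rule closed_in_subset[OF H(1)])
  have "Max (y ` H) \<in> y ` H" using finite_subset[OF HN] s by (intro Max_in) auto
  then obtain m where m: "m \<in> H" "y m = Max (y ` H)" by auto
  have le: "y x \<le> y m" if "x \<in> H" for x unfolding m(2)
    using that finite_subset[OF HN] by (intro Max_ge) auto
  have mN: "m \<in> N v" using m(1) HN by blast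
  have "(\<Sum>w\<in>N m. y w) = y v + (\<Sum>w\<in>N m \<inter> N v. y w)" by (rule sum_N_split[OF mN H(2)[OF m(1)]])
  also have "(\<Sum>w\<in>N m \<inter> N v. y w) \<le> deg_in (N v) m * y m"
    using sum_bounded_above[of "N m \<inter> N v" y "y m"] le closed_in_N_Int[OF H(1) m(1)] by simp
  finally have "(\<Sum>w\<in>N m. y w) \<le> y v + deg_in (N v) m * y m" by simp
  moreover have "(\<mu> - card (N m)) * y m \<le> (\<Sum>w\<in>N m. y w)" using y_sub mN adj_less by simp
  ultimately have "(\<mu> - 2 * deg_in (N v) m - 1) * y m \<le> y v"
    using card_N_split[OF mN] H(2)[OF m(1)] by (simp add: algebra_simps)
  moreover have "(\<mu> - 2 * real k - 1) * y m \<le> (\<mu> - 2 * deg_in (N v) m - 1) * y m"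
    using H(3)[OF m(1)] y_nonneg[of m] by (intro mult_right_mono) auto
  ultimately have "y m \<le> y v / (\<mu> - 2 * real k - 1)" using large by (simp add: field_simps)
  thus ?thesis using le[OF s] by simp
qed

lemma y_le_proportional:
  assumes "u < n" "card (N u) \<le> card (N v)"
  shows "card (N v) * y u \<le> y v * card (N u)"
proof -
  have "card (N v) * y u \<le> card (N v) * (card (N u) - \<alpha>)"
    using y_le[OF assms(1)] by (intro mult_left_mono) auto
  moreover have "\<alpha> * card (N u) \<le> \<alpha> * card (N v)"
    using assms(2) shift by (intro mult_left_mono) auto
  ultimately show ?thesis by (simp add: y_v algebra_simps)
qed

lemma dominating_neighbour_sum:
  assumes "far v = {}"
  shows "(\<mu> - 1) * (\<Sum>s\<in>N v. y s) \<le> card (N v) * y v + 2 * (\<Sum>s\<in>N v. deg_in (N v) s * y s)"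
proof -
  have "(\<Sum>s\<in>N v. (\<mu> - 1 - deg_in (N v) s) * y s) \<le> (\<Sum>s\<in>N v. y v + (\<Sum>w\<in>N s \<inter> N v. y w))"
  proof (rule sum_mono)
    fix s assume s: "s \<in> N v"
    show "(\<mu> - 1 - deg_in (N v) s) * y s \<le> y v + (\<Sum>w\<in>N s \<inter> N v. y w)"
      using y_sub[of s] s adj_less card_N_split[OF s] sum_N_split[OF s, of y] assms
      by (simp add: algebra_simps)
  qed
  also have "\<dots> = card (N v) * y v + (\<Sum>s\<in>N v. deg_in (N v) s * y s)"
    by (simp add: sum.distrib sum_over_neighbours)
  finally show ?thesis by (simp add: algebra_simps sum.distrib sum_subtractf sum_distrib_left)
qed

end

lemma (in fin_graph) normalised_subsolution:
  assumes iso: "no_isolated n E" and n: "0 < n" and shift: "0 \<le> \<alpha>" "\<alpha> < 1" and mu: "\<mu> \<le> q_index n E"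
  obtains v y where "subsolution n E \<mu> \<alpha> v y"
proof -
  obtain z where z: "\<And>u. 0 \<le> z u" "\<exists>u<n. 0 < z u"
    "\<And>u. u < n \<Longrightarrow> q_index n E * z u \<le> (\<Sum>w\<in>N u. z u + z w)"
    using q_index_subsolution[OF n] by metis
  define r where "r u = z u / (card (N u) - \<alpha>)" for u
  have pos: "0 < card (N u) - \<alpha>" if "u < n" for u using card_N_pos[OF iso that] shift by simp
  have "Max (r ` {..<n}) \<in> r ` {..<n}" using n by (intro Max_in) auto
  then obtain v where v: "v < n" "r v = Max (r ` {..<n})" by auto
  have r_le: "r u \<le> r v" if "u < n" for u unfolding v(2) using that by (intro Max_ge) auto
  obtain u where u: "u < n" "0 < z u" using z(2) by blast
  have rv: "0 < r v"
    using r_le[OF u(1)] u pos[OF u(1)] by (simp add: r_def order_less_le_trans[rotated])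
  show thesis
  proof (rule that[of v "\<lambda>u. z u / r v"], unfold_locales)
    show "v < n" by (rule v(1))
    show "1 \<le> card (N v)" by (rule card_N_pos[OF iso v(1)])
    show "z v / r v = card (N v) - \<alpha>" using rv by (auto simp: r_def)
    show "0 \<le> z u / r v" for u using z(1) rv by simp
    show "z u / r v \<le> card (N u) - \<alpha>" if "u < n" for u
    proof -
      have "z u \<le> r v * (card (N u) - \<alpha>)"
        using r_le[OF that] pos[OF that] by (simp add: r_def[of u] pos_divide_le_eq)
      thus ?thesis using rv by (simp add: pos_divide_le_eq mult.commute)
    qed
    show "(\<mu> - card (N u)) * (z u / r v) \<le> (\<Sum>w\<in>N u. z w / r v)" if u: "u < n" for u
    proof -
      have "\<mu> * z u \<le> q_index n E * z u" using mu z(1) by (intro mult_right_mono) auto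
      hence "(\<mu> - card (N u)) * z u \<le> (\<Sum>w\<in>N u. z w)"
        using z(3)[OF u] by (simp add: sum.distrib algebra_simps)
      from divide_right_mono[OF this, of "r v"] show ?thesis
        using rv by (simp add: sum_divide_distrib)
    qed
  qed (use shift in auto)
qed

lemma (in tcc_free) diamond_vertex_bound:
  assumes "subsolution n E \<mu> \<alpha> v y"
    and H: "H \<subseteq> diamonds (N v)" "closed_in (N v) H" "\<And>s. s \<in> H \<Longrightarrow> N s \<inter> far v = {}"
    and large: "7 < \<mu>" and s: "s \<in> H"
  shows "y s \<le> y v / (\<mu> - 7)"
  using subsolution.closed_part_bound[OF assms(1) H(2,3) _ _ s, of 3]
    diamonds_degree_le_3[OF path5_free_N] H(1) large by auto

text \<open>In the extremal graph the index is about \<open>n + 2 - 4 / (n + 4)\<close>; for \<open>n \<le> 10\<close> the gap is at most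
  \<open>27 / 100\<close>, which is smaller than \<open>4 / (n + 4)\<close>.\<close>
locale large_subsolution = subsolution n E \<mu> \<alpha> v y + tcc_free n E
  for n E \<mu> \<alpha> v y +
  fixes \<epsilon> :: real
  assumes order_ge_7: "7 \<le> n" and mu: "\<mu> = real n + 2 - \<epsilon>" and alpha: "\<alpha> = 1 / (real n + 4)"
    and eps: "0 \<le> \<epsilon>" "\<epsilon> \<le> 27 / 100" "\<epsilon> * (real n + 4) \<le> 4"
begin

lemma alpha_mult: "\<alpha> * (real n + 4) = 1"
  by (simp add: alpha)

lemma eps_le_alpha: "\<epsilon> \<le> 4 * \<alpha>"
  using eps(3) by (simp add: alpha field_simps)

lemma eps_alpha_nonneg: "0 \<le> \<epsilon> * \<alpha>"
  using eps shift by simp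

lemma twice_degree_missing_le_real:
  "2 * real (card (N v)) + missing v \<le> edge_count (N v) (N v) + \<alpha> * (2 * real (card (N v)) + real n + 2)"
proof -
  have "\<epsilon> * card (N v) \<le> 4 * \<alpha> * card (N v)" using eps_le_alpha by (intro mult_right_mono) auto
  thus ?thesis using first_order eps_alpha_nonneg by (simp add: mu algebra_simps)
qed

lemma twice_degree_missing_le: "2 * card (N v) + missing v \<le> edge_count (N v) (N v) + 2"
proof -
  have "\<alpha> * (2 * real (card (N v)) + real n + 2) < \<alpha> * (3 * (real n + 4))"
    using card_far[OF v_less] by (intro mult_strict_left_mono) (auto simp: alpha)
  hence "2 * card (N v) + missing v < edge_count (N v) (N v) + (3::real)"
    using twice_degree_missing_le_real alpha_mult by (simp add: algebra_simps)
  thus ?thesis by linarith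
qed

lemma twice_degree_missing_le_low:
  assumes "card (N v) \<le> 4"
  shows "2 * card (N v) + missing v \<le> edge_count (N v) (N v) + 1"
proof -
  have "\<alpha> * (2 * real (card (N v)) + real n + 2) < \<alpha> * (2 * (real n + 4))"
    using assms order_ge_7 by (intro mult_strict_left_mono) (auto simp: alpha)
  hence "2 * card (N v) + missing v < edge_count (N v) (N v) + (2::real)"
    using twice_degree_missing_le_real alpha_mult by (simp add: algebra_simps)
  thus ?thesis by linarith
qed

lemma degree_ge_5: "5 \<le> card (N v)"
proof (rule ccontr)
  assume low: "\<not> ?thesis"
  hence "2 \<le> card (far v)" using card_far[OF v_less] order_ge_7 by simp
  then obtain t u where tu: "t \<in> far v" "u \<in> far v" "t \<noteq> u" by (rule card_ge_2E)
  have "edge_count (N v) (N v) + 1 < 2 * card (N v) + missing v"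
  proof (cases "diamond_free (N v)")
    case True
    moreover have "N v \<noteq> {}" using deg_pos by auto
    ultimately show ?thesis by (rule diamond_free_two_far_sparse[OF _ _ tu])
  next
    case False
    then obtain Q where "diamond Q" "Q \<subseteq> N v" by (rule not_diamond_freeE)
    thus ?thesis by (rule diamond_low_degree_sparse[OF _ _ tu]) (use low in simp)
  qed
  thus False using twice_degree_missing_le_low low by simp
qed

lemma card_far_le_1: "card (far v) \<le> 1"
proof (rule ccontr)
  assume "\<not> ?thesis"
  hence "2 \<le> card (far v)" by simp
  then obtain t u where tu: "t \<in> far v" "u \<in> far v" "t \<noteq> u" by (rule card_ge_2E)
  show False
  proof (cases "diamond_free (N v)")
    case True
    thus False
      using diamond_free_one_far_sparse[OF tu(1) degree_ge_5] missing_ge[OF tu(1)]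
        twice_degree_missing_le
      by linarith
  next
    case False
    then obtain Q where "diamond Q" "Q \<subseteq> N v" by (rule not_diamond_freeE)
    thus False using diamond_two_far_sparse[OF _ _ tu degree_ge_5] twice_degree_missing_le
      by fastforce
  qed
qed

context
  fixes t Q
  assumes far: "far v = {t}" and Q: "diamond Q" "Q \<subseteq> N v"
begin

lemma order_eq: "real n = card (N v) + 2"
  using card_far[OF v_less] far by simp

lemma mu_minus_7: "\<mu> - 7 = real (card (N v)) - 3 - \<epsilon>"
  by (simp add: mu order_eq)

lemma vertex_sum_ge: "(4 - \<epsilon>) * (card (N v) - \<alpha>) \<le> (\<Sum>s\<in>N v. y s)"
  using y_sub[OF v_less] by (simp add: y_v mu order_eq)

lemma unattached_diamond_vertex_le_3:
  assumes "H \<subseteq> diamonds (N v)" "closed_in (N v) H" "\<And>s. s \<in> H \<Longrightarrow> \<not> adj t s" "s \<in> H"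
  shows "y s \<le> 3"
proof -
  have "7 < \<mu>" using mu_minus_7 eps degree_ge_5 by linarith
  hence "y s \<le> y v / (\<mu> - 7)"
    using diamond_vertex_bound[OF subsolution_axioms assms(1,2) _ _ assms(4)] assms(3) far
    by (auto simp: adj_commute)
  also have "\<dots> \<le> 3" unfolding mu_minus_7 using eps shift degree_ge_5 by (simp add: y_v field_simps)
  finally show ?thesis .
qed

lemma diamond_attached_if_one_far: "N t \<inter> diamonds (N v) \<noteq> {}"
proof
  assume free: "N t \<inter> diamonds (N v) = {}"
  let ?d = "real (card (N v))" and ?D = "diamonds (N v)"
  let ?L = "real (card ?D)" and ?R = "N v - ?D"
  note closed = diamonds_closed[OF path5_free_N, of v]
  have R: "?d = ?L + card ?R" using closed_in_card_Diff[OF finite_N closed] by simp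
  have "(\<Sum>s\<in>?D. y s) \<le> 3 * ?L"
  proof -
    have "y s \<le> 3" if "s \<in> ?D" for s
      by (rule unattached_diamond_vertex_le_3[OF subset_refl closed _ that]) (use free in auto)
    thus ?thesis using sum_bounded_above[of ?D y 3] by (simp add: mult.commute)
  qed
  moreover have "(\<Sum>s\<in>?R. y s) \<le> (4 - \<alpha>) * card ?R"
  proof -
    have "edge_count ?R (N v) \<le> 2 * card ?R"
      using edge_count_off_diamonds[OF finite_N path5_free_N, of v]
        closed_in_edge_count[OF closed_in_Diff[OF closed_in_refl closed]] by simp
    moreover have "deg_in (far v) s \<le> 1" for s using card_mono[of "{t}" "N s \<inter> {t}"] far by simp
    hence "edge_count ?R (far v) \<le> card ?R * 1" by (rule edge_count_le)
    ultimately show ?thesis using sum_y_le[of ?R] by (simp add: algebra_simps)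
  qed
  moreover have "(\<Sum>s\<in>N v. y s) = (\<Sum>s\<in>?D. y s) + (\<Sum>s\<in>?R. y s)"
    using sum.subset_diff[OF diamonds_subset finite_N, of y v] by simp
  ultimately have "(4 - \<epsilon>) * (?d - \<alpha>) \<le> 3 * ?L + (4 - \<alpha>) * (?d - ?L)"
    using vertex_sum_ge R by simp
  moreover have "(1 - \<alpha>) * 4 \<le> (1 - \<alpha>) * ?L"
    using card_mono[OF _ diamond_subset_diamonds[OF Q(2,1)]] diamond_card[OF Q(1)] shift
      finite_subset[OF diamonds_subset finite_N]
    by (intro mult_left_mono) auto
  moreover have "\<epsilon> * ?d \<le> 4 * \<alpha> * ?d" using eps_le_alpha by (intro mult_right_mono) auto
  moreover have "\<alpha> * ?d = 1 - 6 * \<alpha>" using alpha_mult by (simp add: order_eq algebra_simps)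
  ultimately show False using shift eps_alpha_nonneg by (simp add: algebra_simps)
qed

context
  assumes attached: "N t \<inter> Q \<noteq> {}"
begin

lemma common_neighbours_in_diamond: "N t \<inter> N v \<subseteq> Q"
proof -
  obtain p where "p \<in> Q" "adj t p" using attached by auto
  thus ?thesis using four_cycle_attached[OF diamond_spans_four_cycle[OF Q(1)] Q(2)] far by blast
qed

lemma attached_diamond_sum_le: "(\<Sum>s\<in>Q. y s) \<le> 17 - 4 * \<alpha>"
proof -
  have "edge_count Q (N v) = edge_count Q Q"
    by (rule closed_in_edge_count[OF diamond_closed[OF path5_free_N Q]])
  moreover have "edge_count Q (far v) = deg_in Q t"
    using edge_count_commute[of Q "{t}"] far diamond_finite[OF Q(1)] by simp
  moreover have "edge_count Q Q + deg_in Q t \<le> 13"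
    using diamond_attached_count[OF Q, of t] diamond_edge_count_le[OF Q(1)] far by simp
  ultimately show ?thesis using sum_y_le[OF Q(2)] diamond_card[OF Q(1)] by simp
qed

lemma closed_off_diamond: "closed_in (N v) (N v - Q)"
  by (rule closed_in_Diff[OF closed_in_refl diamond_closed[OF path5_free_N Q]])

lemma unattached_part_sum_le:
  assumes "closed_in (N v) R" "R \<inter> Q = {}"
  shows "(\<Sum>s\<in>R. y s) \<le> real (card R + edge_count R R)"
proof -
  have sub: "R \<subseteq> N v" by (rule closed_in_subset[OF assms(1)])
  hence "N t \<inter> R = {}" using common_neighbours_in_diamond assms(2) by blast
  hence "edge_count R (far v) = 0"
    using edge_count_commute[of R "{t}"] far finite_subset[OF sub] by simp
  moreover have "0 \<le> \<alpha> * card R" using shift by simp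
  ultimately show ?thesis using sum_y_le[OF sub] closed_in_edge_count[OF assms(1)] by simp
qed

lemma off_diamond_sum_le: "(\<Sum>s\<in>N v - Q. y s) \<le> 3 * card (N v - Q)"
proof -
  let ?H = "diamonds (N v) - Q" and ?R = "N v - diamonds (N v)"
  note closed = diamonds_closed[OF path5_free_N, of v]
  have DQ: "Q \<subseteq> diamonds (N v)" by (rule diamond_subset_diamonds[OF Q(2,1)])
  have H: "closed_in (N v) ?H" by (rule closed_in_Diff[OF closed diamond_closed[OF path5_free_N Q]])
  have unattached: "\<not> adj t s" if "s \<in> ?H" for s
  proof -
    have "s \<in> N v" using diamonds_subset that by blast
    thus ?thesis using common_neighbours_in_diamond that by auto
  qed
  have "y s \<le> 3" if "s \<in> ?H" for s
    by (rule unattached_diamond_vertex_le_3[OF _ H unattached that]) auto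
  hence "(\<Sum>s\<in>?H. y s) \<le> 3 * card ?H" using sum_bounded_above[of ?H y 3] by (simp add: mult.commute)
  moreover have "(\<Sum>s\<in>?R. y s) \<le> 3 * card ?R"
  proof -
    have "(\<Sum>s\<in>?R. y s) \<le> real (card ?R + edge_count ?R ?R)"
      using DQ by (intro unattached_part_sum_le closed_in_Diff[OF closed_in_refl closed]) auto
    thus ?thesis using edge_count_off_diamonds[OF finite_N path5_free_N, of v] by simp
  qed
  moreover have "N v - Q = ?H \<union> ?R" "?H \<inter> ?R = {}" using DQ diamonds_subset by auto
  moreover have "finite ?H" by (rule finite_subset[OF closed_in_subset[OF H]]) simp
  ultimately show ?thesis by (simp add: sum.union_disjoint card_Un_disjoint)
qed

lemma off_diamond_sum_le_small:
  assumes "card (N v) \<le> 6"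
  shows "(\<Sum>s\<in>N v - Q. y s) \<le> 3 * real (card (N v - Q)) - 2"
proof -
  have "card (N v - Q) = card (N v) - 4"
    using card_Diff_subset[OF diamond_finite[OF Q(1)] Q(2)] diamond_card[OF Q(1)] by simp
  hence "card (N v - Q) = 1 \<or> card (N v - Q) = 2" using degree_ge_5 assms by linarith
  moreover have "(\<Sum>s\<in>N v - Q. y s) \<le> real (card (N v - Q) + edge_count (N v - Q) (N v - Q))"
    by (rule unattached_part_sum_le[OF closed_off_diamond]) auto
  moreover have "edge_count (N v - Q) (N v - Q) \<le> card (N v - Q) * (card (N v - Q) - 1)"
    by (rule edge_count_le_complete) simp
  ultimately show ?thesis by auto
qed

lemma attached_diamond_impossible: False
proof -
  let ?d = "real (card (N v))"
  have "(\<Sum>s\<in>N v. y s) = (\<Sum>s\<in>Q. y s) + (\<Sum>s\<in>N v - Q. y s)"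
    using sum.subset_diff[OF Q(2) finite_N, of y] by simp
  moreover have "real (card (N v - Q)) = ?d - 4"
    using card_Diff_subset[OF diamond_finite[OF Q(1)] Q(2)] diamond_card[OF Q(1)] degree_ge_5
    by simp
  ultimately have
    "(4 - \<epsilon>) * (?d - \<alpha>) \<le> 17 - 4 * \<alpha> + 3 * (?d - 4) - (if card (N v) \<le> 6 then 2 else 0)"
    using vertex_sum_ge attached_diamond_sum_le off_diamond_sum_le off_diamond_sum_le_small
    by (cases "card (N v) \<le> 6") simp_all
  hence bound: "?d \<le> 5 + \<epsilon> * ?d - (if card (N v) \<le> 6 then 2 else 0)"
    using eps_alpha_nonneg by (simp add: algebra_simps)
  have "\<epsilon> * ?d \<le> 27 / 100 * ?d" using eps by (intro mult_right_mono) auto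
  hence "73 / 100 * ?d \<le> 5 - (if card (N v) \<le> 6 then 2 else 0)" using bound by linarith
  thus False using degree_ge_5 by (cases "card (N v) \<le> 6") simp_all
qed

end

end

lemma far_empty: "far v = {}"
proof (rule ccontr)
  assume "far v \<noteq> {}"
  hence "card (far v) \<noteq> 0" by simp
  hence "card (far v) = 1" using card_far_le_1 by linarith
  then obtain t where t: "far v = {t}" by (rule card_1_singletonE)
  show False
  proof (cases "diamond_free (N v)")
    case True
    thus False
      using diamond_free_one_far_sparse[of t v] degree_ge_5 missing_ge[of t v]
        twice_degree_missing_le t
      by simp
  next
    case False
    then obtain Q where Q: "diamond Q" "Q \<subseteq> N v" by (rule not_diamond_freeE)
    obtain p where p: "adj t p" "p \<in> diamonds (N v)"
      using diamond_attached_if_one_far[OF t Q] by auto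
    then obtain Q where Q: "Q \<subseteq> N v" "diamond Q" "p \<in> Q" by (elim in_diamondsE)
    have "N t \<inter> Q \<noteq> {}" using Q(3) p(1) by auto
    thus False by (rule attached_diamond_impossible[OF t Q(2,1)])
  qed
qed

lemma order_eq_degree: "real n = card (N v) + 1"
  using card_far[OF v_less] far_empty by simp

lemma degree_ge_6: "6 \<le> card (N v)"
  using order_eq_degree order_ge_7 by simp

lemma dominating_sum_ge: "(3 - \<epsilon>) * y v \<le> (\<Sum>s\<in>N v. y s)"
  using y_sub[OF v_less] by (simp add: mu order_eq_degree)

lemma neighbour_degree_le:
  assumes "s \<in> N v"
  shows "s < n" "card (N s) \<le> card (N v)"
proof -
  show "s < n" using assms adj_less by simp
  have "card (N s) \<le> card ({..<n} - {s})" by (intro card_mono N_subset) simp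
  also have "\<dots> = card (N v)" using \<open>s < n\<close> order_eq_degree by simp
  finally show "card (N s) \<le> card (N v)" .
qed

lemma second_order: "oblong (card (N v)) \<le> oblong_sum (N v)"
proof -
  let ?d = "real (card (N v))" and ?g = "\<lambda>s. real (deg_in (N v) s)"
  have "(\<mu> - 1) * ((3 - \<epsilon>) * y v) \<le> (\<mu> - 1) * (\<Sum>s\<in>N v. y s)"
    using dominating_sum_ge eps order_ge_7 by (intro mult_left_mono) (auto simp: mu)
  also have "\<dots> \<le> ?d * y v + 2 * (\<Sum>s\<in>N v. ?g s * y s)"
    by (rule dominating_neighbour_sum[OF far_empty])
  finally have "((\<mu> - 1) * (3 - \<epsilon>) - ?d) * y v \<le> 2 * (\<Sum>s\<in>N v. ?g s * y s)"
    by (simp add: algebra_simps)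
  moreover have "2 * (?d + 1) * y v \<le> ((\<mu> - 1) * (3 - \<epsilon>) - ?d) * y v"
  proof (rule mult_right_mono)
    have "(\<mu> - 1) * (3 - \<epsilon>) - ?d = 2 * (?d + 1) + (4 - \<epsilon> * (real n + 4)) + \<epsilon> * \<epsilon>"
      unfolding mu order_eq_degree by (simp add: algebra_simps)
    thus "2 * (?d + 1) \<le> (\<mu> - 1) * (3 - \<epsilon>) - ?d" using eps(3) zero_le_square[of \<epsilon>] by linarith
  qed (use y_v_pos in simp)
  ultimately have "2 * (?d + 1) * y v \<le> 2 * (\<Sum>s\<in>N v. ?g s * y s)" by linarith
  hence "(?d + 1) * y v \<le> (\<Sum>s\<in>N v. ?g s * y s)" unfolding mult.assoc by linarith
  hence "?d * ((?d + 1) * y v) \<le> ?d * (\<Sum>s\<in>N v. ?g s * y s)" by (rule mult_left_mono) simp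
  also have "\<dots> \<le> y v * (\<Sum>s\<in>N v. ?g s * (?g s + 1))"
    unfolding sum_distrib_left
  proof (rule sum_mono)
    fix s assume s: "s \<in> N v"
    have "?g s * (?d * y s) \<le> ?g s * (y v * card (N s))"
      using y_le_proportional neighbour_degree_le[OF s] by (intro mult_left_mono) auto
    thus "?d * (?g s * y s) \<le> y v * (?g s * (?g s + 1))"
      using card_N_split[OF s] far_empty by (simp add: algebra_simps)
  qed
  finally have "y v * (?d * (?d + 1)) \<le> y v * (\<Sum>s\<in>N v. ?g s * (?g s + 1))"
    by (simp add: algebra_simps)
  hence "?d * (?d + 1) \<le> (\<Sum>s\<in>N v. ?g s * (?g s + 1))" using y_v_pos by simp
  hence "real (oblong (card (N v))) \<le> real (oblong_sum (N v))"
    by (simp add: oblong_def oblong_sum_def algebra_simps)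
  thus ?thesis by (simp only: of_nat_le_iff)
qed

lemma diamonds_sum_le:
  "(\<Sum>s\<in>diamonds (N v). y s) \<le> card (diamonds (N v)) / (real (card (N v)) - 4 - \<epsilon>) * y v"
proof -
  have shifted: "\<mu> - 7 = real (card (N v)) - 4 - \<epsilon>" by (simp add: mu order_eq_degree)
  have "7 < \<mu>" using shifted eps degree_ge_6 by linarith
  hence "y s \<le> y v / (\<mu> - 7)" if "s \<in> diamonds (N v)" for s
    using diamond_vertex_bound[OF subsolution_axioms subset_refl
        diamonds_closed[OF path5_free_N] _ _ that]
      far_empty by simp
  from sum_bounded_above[of _ y, OF this] show ?thesis unfolding shifted by simp
qed

lemma off_diamonds_sum_le:
  "(\<Sum>s\<in>N v - diamonds (N v). y s) \<le> 3 * card (N v - diamonds (N v)) / card (N v) * y v"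
proof -
  let ?R = "N v - diamonds (N v)"
  have "card (N v) * (\<Sum>s\<in>?R. y s) \<le> (\<Sum>s\<in>?R. y v * card (N s))"
    unfolding sum_distrib_left using y_le_proportional neighbour_degree_le by (intro sum_mono) auto
  also have "\<dots> = y v * real (\<Sum>s\<in>?R. card (N s))" by (simp add: sum_distrib_left)
  also have "(\<Sum>s\<in>?R. card (N s)) = card ?R + edge_count ?R ?R"
    using sum_card_N[of ?R v] far_empty
      closed_in_edge_count[OF closed_in_Diff[OF closed_in_refl diamonds_closed[OF path5_free_N]]]
    by (simp add: edge_count_def)
  also have "y v * real (card ?R + edge_count ?R ?R) \<le> y v * (3 * card ?R)"
    using edge_count_off_diamonds[OF finite_N path5_free_N, of v] y_v_pos
    by (intro mult_left_mono) auto
  finally show ?thesis using degree_ge_6 by (simp add: field_simps)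
qed

end

lemma diamond_weight_inequality:
  fixes d L \<epsilon> :: real
  assumes "8 \<le> d" "4 \<le> L" "0 \<le> \<epsilon>" "\<epsilon> \<le> 1" "\<epsilon> * (d + 5) \<le> 4"
  shows "L / (d - 4 - \<epsilon>) + 3 * (d - L) / d < 3 - \<epsilon>"
proof -
  have pos: "0 < d * (d - 4 - \<epsilon>)" using assms by simp
  have "\<epsilon> * d * (d - 4 - \<epsilon>) < 4 * (2 * d - 12 - 3 * \<epsilon>)"
  proof (cases "\<epsilon> = 0")
    case False
    have "\<epsilon> * d * (d - 4 - \<epsilon>) \<le> (4 - 5 * \<epsilon>) * (d - 4 - \<epsilon>)"
      using assms by (intro mult_right_mono) (auto simp: algebra_simps)
    also have "\<dots> = 4 * (2 * d - 12 - 3 * \<epsilon>) - 4 * (d - 8) - \<epsilon> * (5 * d - 28 - 5 * \<epsilon>)"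
      by (simp add: algebra_simps)
    also have "0 < \<epsilon> * (5 * d - 28 - 5 * \<epsilon>)" using False assms by (intro mult_pos_pos) auto
    hence "4 * (2 * d - 12 - 3 * \<epsilon>) - 4 * (d - 8) - \<epsilon> * (5 * d - 28 - 5 * \<epsilon>) < 4 * (2 * d - 12 - 3 * \<epsilon>)"
      using assms(1) by simp
    finally show ?thesis .
  qed (use assms in simp)
  also have "\<dots> \<le> L * (2 * d - 12 - 3 * \<epsilon>)" using assms by (intro mult_right_mono) auto
  finally have "\<epsilon> < L * (2 * d - 12 - 3 * \<epsilon>) / (d * (d - 4 - \<epsilon>))"
    using pos by (simp add: pos_less_divide_eq mult.assoc)
  also have "\<dots> = L * (3 / d - 1 / (d - 4 - \<epsilon>))" using assms by (simp add: field_simps)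
  finally have "\<epsilon> < L * (3 / d - 1 / (d - 4 - \<epsilon>))" .
  moreover have "3 * (d - L) / d = 3 - L * (3 / d)" using assms(1) by (simp add: field_simps)
  ultimately show ?thesis by (simp add: right_diff_distrib)
qed

context large_subsolution
begin

lemma small_off_diamond_sum_le:
  assumes D: "card (diamonds (N v)) = 4" and degree: "card (N v) \<le> 7"
  shows "(\<Sum>s\<in>N v - diamonds (N v). y s) \<le> (real (card (N v)) - 4) / (12 - real (card (N v)) - \<epsilon>) * y v"
proof -
  let ?d = "card (N v)" and ?R = "N v - diamonds (N v)"
  have closed: "closed_in (N v) ?R"
    by (rule closed_in_Diff[OF closed_in_refl diamonds_closed[OF path5_free_N]])
  have R: "card ?R = ?d - 4"
    using closed_in_card_Diff[OF finite_N diamonds_closed[OF path5_free_N], of v] D by simp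
  have deg: "deg_in (N v) s \<le> ?d - 5" if "s \<in> ?R" for s
    using deg_in_less_card[OF _ that] closed_in_N_Int[OF closed that] R by simp
  have denominator: "\<mu> - 2 * real (?d - 5) - 1 = 12 - real ?d - \<epsilon>"
    using degree_ge_6 by (simp add: mu order_eq_degree of_nat_diff)
  hence large: "2 * real (?d - 5) + 1 < \<mu>" using degree eps by linarith
  have "y s \<le> y v / (12 - real ?d - \<epsilon>)" if "s \<in> ?R" for s
    unfolding denominator[symmetric]
    by (rule closed_part_bound[OF closed _ deg large that]) (simp add: far_empty)
  from sum_bounded_above[of ?R y, OF this] show ?thesis
    using R degree_ge_6 by (simp add: of_nat_diff)
qed

lemma diamond_free_N_v: "diamond_free (N v)"
proof (rule ccontr)
  assume "\<not> ?thesis"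
  then obtain Q where Q: "diamond Q" "Q \<subseteq> N v" by (rule not_diamond_freeE)
  let ?d = "real (card (N v))" and ?D = "diamonds (N v)"
  let ?L = "real (card ?D)"
  note card = closed_in_card_Diff[OF finite_N diamonds_closed[OF path5_free_N], of v]
  have sum: "(\<Sum>s\<in>N v. y s) = (\<Sum>s\<in>?D. y s) + (\<Sum>s\<in>N v - ?D. y s)"
    using sum.subset_diff[OF diamonds_subset finite_N, of y v] by simp
  have L: "?D = Q \<or> 8 \<le> card ?D" by (rule diamonds_eq_or_card_ge_8[OF path5_free_N finite_N Q(2,1)])
  have "\<exists>b. (\<Sum>s\<in>N v - ?D. y s) \<le> b * y v \<and> ?L / (?d - 4 - \<epsilon>) + b < 3 - \<epsilon>"
  proof (cases "8 \<le> card (N v)")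
    case True
    have "4 \<le> ?L" using L diamond_card[OF Q(1)] by auto
    hence "?L / (?d - 4 - \<epsilon>) + 3 * (?d - ?L) / ?d < 3 - \<epsilon>"
      using True eps order_eq_degree by (intro diamond_weight_inequality) (auto simp: algebra_simps)
    moreover have "real (card (N v - ?D)) = ?d - ?L" using card by simp
    ultimately show ?thesis using off_diamonds_sum_le by (intro exI[of _ "3 * (?d - ?L) / ?d"]) simp
  next
    case False
    hence single: "card ?D = 4" using L card diamond_card[OF Q(1)] by auto
    have shrink: "1 / (k - \<epsilon>) \<le> 1 / (k - 27 / 100)" if "1 \<le> k" for k :: real
      using eps that by (intro divide_left_mono) auto
    have "card (N v) = 6 \<or> card (N v) = 7" using False degree_ge_6 by linarith
    hence "4 / (?d - 4 - \<epsilon>) + (?d - 4) / (12 - ?d - \<epsilon>) < 3 - \<epsilon>"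
      using shrink[of 2] shrink[of 6] shrink[of 3] shrink[of 5] eps(2) by (elim disjE) simp_all
    thus ?thesis
      using small_off_diamond_sum_le[OF single] False single
      by (intro exI[of _ "(?d - 4) / (12 - ?d - \<epsilon>)"]) simp
  qed
  then obtain b where b: "(\<Sum>s\<in>N v - ?D. y s) \<le> b * y v" "?L / (?d - 4 - \<epsilon>) + b < 3 - \<epsilon>" by blast
  hence "(3 - \<epsilon>) * y v \<le> (?L / (?d - 4 - \<epsilon>) + b) * y v"
    using dominating_sum_ge diamonds_sum_le sum by (simp add: distrib_right)
  thus False using b(2) y_v_pos by simp
qed

end

section \<open>The extremal graphs\<close>

lemma adjacent_K112_plus:
  "adjacent (K112_plus n) i j \<longleftrightarrow> i \<noteq> j \<and> i < n \<and> j < n \<and> (i \<le> 1 \<or> j \<le> 1 \<or> {i, j} = {2, 3})"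
  unfolding adjacent_def K112_plus_def by (auto simp: doubleton_eq_iff)

lemma adjacent_K1_join_K4_K1:
  "adjacent K1_join_K4_K1 i j \<longleftrightarrow> i \<noteq> j \<and> i < 6 \<and> j < 6 \<and> (i = 0 \<or> j = 0 \<or> (i \<noteq> 5 \<and> j \<noteq> 5))"
proof -
  have "adjacent K1_join_K4_K1 i j \<longleftrightarrow>
    i \<noteq> j \<and> i < 6 \<and> j < 6 \<and> (i = 0 \<or> j = 0 \<or> (1 \<le> i \<and> i \<le> 4 \<and> 1 \<le> j \<and> j \<le> 4))"
    unfolding adjacent_def K1_join_K4_K1_def by (auto simp: doubleton_eq_iff)
  thus ?thesis by auto
qed

interpretation K112_plus: fin_graph n "K112_plus n" for n
  by unfold_locales (auto simp: simple_graph_def K112_plus_def)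

interpretation K1_join_K4_K1: fin_graph 6 K1_join_K4_K1
  by unfold_locales (auto simp: simple_graph_def K1_join_K4_K1_def)

lemma N_K112_plus:
  assumes "7 \<le> n"
  shows "u \<le> 1 \<Longrightarrow> K112_plus.N n u = insert (1 - u) (insert 2 (insert 3 {4..<n}))"
    "u \<in> {2, 3} \<Longrightarrow> K112_plus.N n u = {0, 1, 5 - u}"
    "4 \<le> u \<Longrightarrow> u < n \<Longrightarrow> K112_plus.N n u = {0, 1}"
  using assms unfolding K112_plus.N_def adjacent_K112_plus
  by (auto simp: doubleton_eq_iff) presburger

lemma N_K1_join_K4_K1:
  "K1_join_K4_K1.N 0 = insert 5 {1..4}"
  "1 \<le> u \<Longrightarrow> u \<le> 4 \<Longrightarrow> K1_join_K4_K1.N u = insert 0 ({1..4} - {u})"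
  "K1_join_K4_K1.N 5 = {0}"
  unfolding K1_join_K4_K1.N_def adjacent_K1_join_K4_K1 by auto

text \<open>The cubic is the characteristic polynomial of the quotient by the equitable partition
  \<open>{0, 1}\<close>, \<open>{2, 3}\<close>, \<open>{4..<n}\<close>.\<close>
lemma q_index_K112_plus_ge_root:
  assumes n: "7 \<le> n" and k: "4 < k"
    and root: "(k - real n) * (k - 4) * (k - 2) = 4 * (k - 2) + 2 * (real n - 4) * (k - 4)"
  shows "k \<le> q_index n (K112_plus n)"
proof -
  define a where "a = 2 / (k - 4)"
  define b where "b = 2 / (k - 2)"
  have "k - 4 \<noteq> 0" "k - 2 \<noteq> 0" using k by auto
  hence a: "a * (k - 4) = 2" and b: "b * (k - 2) = 2"
    unfolding a_def b_def by (metis nonzero_eq_divide_eq)+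
  have "(k - real n) * ((k - 4) * (k - 2))
      = 2 * (a * (k - 4)) * (k - 2) + (real n - 4) * (b * (k - 2)) * (k - 4)"
    unfolding a b using root by (simp add: mult.assoc)
  also have "\<dots> = (2 * a + (real n - 4) * b) * ((k - 4) * (k - 2))" by (simp add: algebra_simps)
  finally have hub: "k - real n = 2 * a + (real n - 4) * b" using k by simp
  define z where "z u = (if u \<le> 1 then 1 else if u \<le> 3 then a else b)" for u :: nat
  show ?thesis
  proof (rule K112_plus.q_index_ge_eigenvalue[of 0 n z k])
    fix u assume u: "u < n"
    consider "u \<le> 1" | "u \<in> {2, 3}" | "4 \<le> u" by force
    thus "(\<Sum>w\<in>K112_plus.N n u. z u + z w) = k * z u"
    proof cases
      case 1
      hence "u = 0 \<or> u = 1" by linarith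
      hence "(\<Sum>w\<in>K112_plus.N n u. z u + z w) = 2 + 2 * (1 + a) + (real n - 4) * (1 + b)"
        unfolding N_K112_plus(1)[OF n 1]
        by (elim disjE) (use n in \<open>simp_all add: z_def of_nat_diff algebra_simps\<close>)
      thus ?thesis using hub 1 by (simp add: z_def algebra_simps)
    next
      case 2
      thus ?thesis unfolding N_K112_plus(2)[OF n 2] using a by (auto simp: z_def algebra_simps)
    next
      case 3
      thus ?thesis unfolding N_K112_plus(3)[OF n 3 u] using b by (simp add: z_def algebra_simps)
    qed
  qed (use n in \<open>auto simp: z_def\<close>)
qed

lemma q_index_K112_plus_ge:
  assumes n: "7 \<le> n" and e: "0 \<le> \<epsilon>" "\<epsilon> \<le> 1" "4 * real n - 16 \<le> \<epsilon> * (real n - \<epsilon>)\<^sup>2"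
  shows "real n + 2 - \<epsilon> \<le> q_index n (K112_plus n)"
proof -
  define h where
    "h x = (x - real n) * (x - 4) * (x - 2) - 4 * (x - 2) - 2 * (real n - 4) * (x - 4)" for x
  have shifted: "h (real n + 2 - t) = 4 * real n - 16 - t * (real n - t)\<^sup>2" for t
    unfolding h_def by (simp add: power2_eq_square algebra_simps)
  have "\<exists>x. real n + 2 - \<epsilon> \<le> x \<and> x \<le> real n + 2 \<and> h x = 0"
  proof (rule IVT')
    show "h (real n + 2 - \<epsilon>) \<le> 0" unfolding shifted using e by simp
    show "0 \<le> h (real n + 2)" using shifted[of 0] n by simp
    show "real n + 2 - \<epsilon> \<le> real n + 2" using e by simp
    show "continuous_on {real n + 2 - \<epsilon>..real n + 2} h" unfolding h_def by (intro continuous_intros)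
  qed
  then obtain k where k: "real n + 2 - \<epsilon> \<le> k" "h k = 0" by blast
  have "k \<le> q_index n (K112_plus n)"
    using k e n by (intro q_index_K112_plus_ge_root) (auto simp: h_def)
  thus ?thesis using k(1) by simp
qed

lemma q_index_K1_join_K4_K1_ge_root:
  assumes k: "7 < k" and root: "(k - 5) * (k - 7) * (k - 1) = 4 * (k - 1) + (k - 7)"
  shows "k \<le> q_index 6 K1_join_K4_K1"
proof -
  define a where "a = 1 / (k - 7)"
  define b where "b = 1 / (k - 1)"
  have a: "a * (k - 7) = 1" and b: "b * (k - 1) = 1" using k by (simp_all add: a_def b_def)
  have "(k - 5) * ((k - 7) * (k - 1)) = 4 * (a * (k - 7)) * (k - 1) + (b * (k - 1)) * (k - 7)"
    unfolding a b using root by (simp add: mult.assoc)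
  also have "\<dots> = (4 * a + b) * ((k - 7) * (k - 1))" by (simp add: algebra_simps)
  finally have hub: "k - 5 = 4 * a + b" using k by simp
  define z where "z u = (if u = 0 then 1 else if u \<le> 4 then a else b)" for u :: nat
  have z: "z 0 = 1" "\<And>u. 1 \<le> u \<Longrightarrow> u \<le> 4 \<Longrightarrow> z u = a" "z 5 = b" by (auto simp: z_def)
  show ?thesis
  proof (rule K1_join_K4_K1.q_index_ge_eigenvalue[of 0 z k])
    fix u :: nat assume "u < 6"
    then consider "u = 0" | "1 \<le> u" "u \<le> 4" | "u = 5" by linarith
    thus "(\<Sum>w\<in>K1_join_K4_K1.N u. z u + z w) = k * z u"
    proof cases
      case 1
      show ?thesis unfolding 1 N_K1_join_K4_K1 using hub z by simp
    next
      case 2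
      have "(\<Sum>w\<in>{1..4} - {u}. z u + z w) = (\<Sum>w\<in>{1..4} - {u}. 2 * a)"
        using z 2 by (intro sum.cong) auto
      also have "\<dots> = 6 * a" using 2 by simp
      finally show ?thesis unfolding N_K1_join_K4_K1(2)[OF 2]
        using a z 2 by (simp add: algebra_simps)
    next
      case 3
      show ?thesis unfolding 3 N_K1_join_K4_K1 using b z by (simp add: algebra_simps)
    qed
  qed (use z in auto)
qed

lemma q_index_K1_join_K4_K1_ge: "827 / 100 \<le> q_index 6 K1_join_K4_K1"
proof -
  define h where "h x = (x - 5) * (x - 7) * (x - 1) - 4 * (x - 1) - (x - 7)" for x :: real
  have "\<exists>x. 827 / 100 \<le> x \<and> x \<le> 9 \<and> h x = 0"
  proof (rule IVT')
    show "continuous_on {827 / 100..9} h" unfolding h_def by (intro continuous_intros)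
  qed (auto simp: h_def)
  then obtain k where k: "827 / 100 \<le> k" "h k = 0" by blast
  have "k \<le> q_index 6 K1_join_K4_K1"
    using k by (intro q_index_K1_join_K4_K1_ge_root) (auto simp: h_def)
  thus ?thesis using k(1) by simp
qed

lemma K112_plus_index_gap:
  fixes n :: nat
  assumes n: "7 \<le> n"
  obtains \<epsilon> :: real
    where "0 \<le> \<epsilon>" "\<epsilon> \<le> 27 / 100" "\<epsilon> * (real n + 4) \<le> 4" "4 * real n - 16 \<le> \<epsilon> * (real n - \<epsilon>)\<^sup>2"
proof (cases "4 / (real n + 4) \<le> 27 / 100")
  case True
  let ?e = "4 / (real n + 4)"
  have "real n + 4 \<noteq> 0" by linarith
  hence eps_mult: "?e * (real n + 4) = 4" by (metis nonzero_eq_divide_eq)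
  hence "?e * real n \<le> 4" by (simp add: field_simps)
  moreover have "(real n - t)\<^sup>2 = (real n + 4) * (real n - 4) + (16 - 2 * (t * real n)) + t\<^sup>2" for t
    by (simp add: power2_eq_square algebra_simps)
  ultimately have "(real n + 4) * (real n - 4) \<le> (real n - ?e)\<^sup>2"
    using zero_le_power2[of ?e] by (simp only:)
  hence "?e * ((real n + 4) * (real n - 4)) \<le> ?e * (real n - ?e)\<^sup>2" by (intro mult_left_mono) auto
  moreover have "?e * ((real n + 4) * (real n - 4)) = 4 * real n - 16"
    using eps_mult by (simp flip: mult.assoc)
  ultimately show thesis using that[of ?e] True eps_mult by simp
next
  case False
  have "0 \<le> 27 / 100 * (real n - 77 / 10)\<^sup>2" by simp
  hence "4 * real n - 16 \<le> 27 / 100 * (real n - 27 / 100)\<^sup>2"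
    using n by (simp add: power2_eq_square algebra_simps)
  moreover have "27 / 100 * (real n + 4) \<le> 4" using False by (simp add: field_simps)
  ultimately show thesis using that[of "27 / 100"] by simp
qed

lemma bij_betw_enumerating:
  assumes "distinct xs" "set xs \<subseteq> {0..<n}"
  obtains f where "bij_betw f {0..<n} {0..<n}" "\<forall>i<length xs. f (xs ! i) = i"
proof -
  define ys where "ys = xs @ sorted_list_of_set ({0..<n} - set xs)"
  have set: "set ys = {0..<n}" and "distinct ys" using assms by (auto simp: ys_def)
  hence len: "length ys = n" using distinct_card[of ys] by simp
  have nth: "bij_betw (nth ys) {0..<n} {0..<n}"
    using bij_betw_nth[OF \<open>distinct ys\<close>, of "{0..<n}"] set len by (simp add: lessThan_atLeast0)
  show ?thesis
  proof (rule that)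
    show "bij_betw (the_inv_into {0..<n} (nth ys)) {0..<n} {0..<n}"
      by (rule bij_betw_the_inv_into[OF nth])
    show "\<forall>i<length xs. the_inv_into {0..<n} (nth ys) (xs ! i) = i"
    proof (intro allI impI)
      fix i assume "i < length xs"
      moreover have "length xs \<le> n" using len by (simp add: ys_def)
      ultimately have "i \<in> {0..<n}" "ys ! i = xs ! i" by (auto simp: ys_def nth_append)
      thus "the_inv_into {0..<n} (nth ys) (xs ! i) = i"
        using the_inv_into_f_f[OF bij_betw_imp_inj_on[OF nth]] by metis
    qed
  qed
qed

lemma graph_isoI:
  assumes f: "bij_betw f {0..<n} {0..<n}"
    and "\<And>u x. u < n \<Longrightarrow> x < n \<Longrightarrow> f u < n \<Longrightarrow> f x < n \<Longrightarrow> inj_on f {0..<n} \<Longrightarrow>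
      adjacent E u x \<longleftrightarrow> adjacent E' (f u) (f x)"
  shows "graph_iso n E E'"
  unfolding graph_iso_def
proof (intro exI[of _ f] conjI allI impI f)
  fix u x assume "u < n" "x < n"
  thus "{u, x} \<in> E \<longleftrightarrow> {f u, f x} \<in> E'"
    using assms(2)[of u x] bij_betw_imp_inj_on[OF f] bij_betwE[OF f] by (simp add: adjacent_def)
qed

lemma graph_iso_K112_plus:
  assumes "distinct [v, w, p, q]" "{v, w, p, q} \<subseteq> {0..<n}"
    and E: "\<And>u x. u < n \<Longrightarrow> x < n \<Longrightarrow> adjacent E u x \<longleftrightarrow>
      u \<noteq> x \<and> (u \<in> {v, w} \<or> x \<in> {v, w} \<or> {u, x} = {p, q})"
  shows "graph_iso n E (K112_plus n)"
proof -
  have "set [v, w, p, q] \<subseteq> {0..<n}" using assms(2) by simp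
  then obtain f where f: "bij_betw f {0..<n} {0..<n}" "\<forall>i<length [v, w, p, q]. f ([v, w, p, q] ! i) = i"
    using bij_betw_enumerating[OF assms(1)] by metis
  have labels: "f v = 0" "f w = 1" "f p = 2" "f q = 3"
    using f(2)[rule_format, of 0] f(2)[rule_format, of 1] f(2)[rule_format, of 2]
      f(2)[rule_format, of 3] by simp_all
  show ?thesis
  proof (rule graph_isoI[OF f(1)])
    fix u x assume *: "u < n" "x < n" "f u < n" "f x < n" "inj_on f {0..<n}"
    have eq_iff: "f a = f b \<longleftrightarrow> a = b" if "a < n" "b < n" for a b
      using inj_on_eq_iff[OF *(5)] that by simp
    have label: "f a \<le> 1 \<longleftrightarrow> a \<in> {v, w}" "f a = 2 \<longleftrightarrow> a = p" "f a = 3 \<longleftrightarrow> a = q" if "a < n" for a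
      using eq_iff[OF that, of v] eq_iff[OF that, of w] eq_iff[OF that, of p] eq_iff[OF that, of q]
        assms(2) labels by (auto simp: le_Suc_eq)
    show "adjacent E u x \<longleftrightarrow> adjacent (K112_plus n) (f u) (f x)"
      unfolding E[OF *(1,2)] adjacent_K112_plus doubleton_eq_iff
      by (simp only: label[OF *(1)] label[OF *(2)] eq_iff[OF *(1,2)] *(3,4) simp_thms)
  qed
qed

lemma graph_iso_K1_join_K4_K1:
  assumes "v < 6" "s < 6" "v \<noteq> s"
    and E: "\<And>i j. i < 6 \<Longrightarrow> j < 6 \<Longrightarrow> adjacent E i j \<longleftrightarrow> i \<noteq> j \<and> (i = v \<or> j = v \<or> (i \<noteq> s \<and> j \<noteq> s))"
  shows "graph_iso 6 E K1_join_K4_K1"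
proof -
  let ?xs = "v # sorted_list_of_set ({0..<6} - {v, s}) @ [s]"
  have "distinct ?xs" "set ?xs \<subseteq> {0..<6}" "length ?xs = 6"
    using assms(1-3) by (auto simp: card_Diff_subset)
  then obtain f where f: "bij_betw f {0..<6} {0..<6}" "\<forall>i<6. f (?xs ! i) = i"
    using bij_betw_enumerating[of ?xs 6] by metis
  have "?xs ! 0 = v" "?xs ! 5 = s" using assms(1-3) by (simp_all add: nth_append card_Diff_subset)
  hence labels: "f v = 0" "f s = 5"
    using f(2)[rule_format, of 0] f(2)[rule_format, of 5] by simp_all
  show ?thesis
  proof (rule graph_isoI[OF f(1)])
    fix i j assume *: "i < 6" "j < 6" "f i < 6" "f j < 6" "inj_on f {0..<6}"
    have eq_iff: "f a = f b \<longleftrightarrow> a = b" if "a < 6" "b < 6" for a b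
      using inj_on_eq_iff[OF *(5)] that by simp
    have label: "f a = 0 \<longleftrightarrow> a = v" "f a = 5 \<longleftrightarrow> a = s" if "a < 6" for a
      using eq_iff[OF that assms(1)] eq_iff[OF that assms(2)] labels by simp_all
    show "adjacent E i j \<longleftrightarrow> adjacent K1_join_K4_K1 (f i) (f j)"
      unfolding E[OF *(1,2)] adjacent_K1_join_K4_K1
      by (simp only: label[OF *(1)] label[OF *(2)] eq_iff[OF *(1,2)] *(3,4) simp_thms)
  qed
qed

lemma (in large_subsolution) iso_K112_plus: "graph_iso n E (K112_plus n)"
proof -
  obtain w p q where w: "w \<in> N v" "N v - {w} \<subseteq> N w"
    and pq: "p \<in> N v - {w}" "q \<in> N v - {w}" "adj p q"
    and unique: "\<forall>x\<in>N v - {w}. \<forall>z\<in>N v - {w}. adj x z \<longrightarrow> {x, z} = {p, q}"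
    by (rule oblong_sum_extremal[OF finite_N path5_free_N diamond_free_N_v degree_ge_6 second_order])
  note v_adj = far_empty_adj[OF far_empty]
  have dominating: "adj u x" if "u \<in> {v, w}" "x < n" "x \<noteq> u" for u x
    using that w v_adj[of x] by (cases "x = v") (auto simp: adj_commute)
  show ?thesis
  proof (rule graph_iso_K112_plus)
    show "distinct [v, w, p, q]" using w(1) pq by auto
    show "{v, w, p, q} \<subseteq> {0..<n}" using w(1) pq v_less adj_less by auto
    fix u x assume ux: "u < n" "x < n"
    show "adj u x \<longleftrightarrow> u \<noteq> x \<and> (u \<in> {v, w} \<or> x \<in> {v, w} \<or> {u, x} = {p, q})"
    proof (cases "u \<in> {v, w} \<or> x \<in> {v, w}")
      case True
      thus ?thesis using dominating[of u x] dominating[of x u] ux adj_commute[of u x] by auto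
    next
      case False
      hence "u \<in> N v - {w}" "x \<in> N v - {w}" using ux v_adj by auto
      hence "adj u x \<Longrightarrow> {u, x} = {p, q}" using unique by blast
      moreover have "{u, x} = {p, q} \<Longrightarrow> adj u x"
        using pq(3) by (auto simp: doubleton_eq_iff adj_commute)
      ultimately show ?thesis using False by auto
    qed
  qed
qed

locale order_6_subsolution = subsolution 6 E "827 / 100" 0 v y + tcc_free 6 E for E v y
begin

lemma degree_missing_le: "227 / 100 * real (card (N v)) + missing v \<le> edge_count (N v) (N v)"
  using first_order by simp

lemma not_diamond_free: "\<not> diamond_free (N v)"
proof
  assume "diamond_free (N v)"
  hence "edge_count (N v) (N v) \<le> 2 * card (N v)"
    by (rule edge_count_le_twice_card[OF finite_N path5_free_N])
  hence "real (edge_count (N v) (N v)) \<le> 2 * real (card (N v))" by linarith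
  thus False using degree_missing_le deg_pos by linarith
qed

lemma far_empty: "far v = {}"
proof (rule ccontr)
  assume "far v \<noteq> {}"
  then obtain t where t: "t \<in> far v" by blast
  obtain Q where Q: "diamond Q" "Q \<subseteq> N v" using not_diamond_freeE[OF not_diamond_free] .
  have "card (far v) \<noteq> 0" using t by auto
  hence "card (N v) \<le> 4" using card_far[OF v_less] by linarith
  hence NQ: "N v = Q" using card_seteq[OF finite_N Q(2)] diamond_card[OF Q(1)] by simp
  have "edge_count Q Q + 2 * deg_in Q t \<le> 14" by (rule diamond_attached_count[OF Q t])
  moreover have "deg_in Q t + card (N v - N t) = 4"
    using card_N_Int_Diff[of t v] NQ diamond_card[OF Q(1)] by simp
  moreover have "13 < edge_count Q Q + deg_in Q t"
    using degree_missing_le missing_ge[OF t] calculation(2) NQ diamond_card[OF Q(1)] by simp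
  ultimately show False using diamond_edge_count_le[OF Q(1)] by linarith
qed

lemma neighbourhood_K4_K1:
  obtains Q s where "N v = insert s Q" "s \<notin> Q" "clique Q" "closed_in (N v) Q"
proof -
  obtain Q where Q: "diamond Q" "Q \<subseteq> N v" using not_diamond_freeE[OF not_diamond_free] .
  have closed: "closed_in (N v) Q" by (rule diamond_closed[OF path5_free_N Q])
  have degree: "card (N v) = 5" using card_far[OF v_less] far_empty by simp
  hence "card (N v - Q) = 1"
    using closed_in_card_Diff[OF finite_N closed] diamond_card[OF Q(1)] by simp
  then obtain s where s: "N v - Q = {s}" by (rule card_1_singletonE)
  have "N v = Q \<union> (N v - Q)" using Q(2) by blast
  hence "N v = insert s Q" unfolding s by simp
  moreover have "s \<in> N v - Q" unfolding s by simp
  moreover have "edge_count (N v) (N v) = edge_count Q Q"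
    using edge_count_closed_split[OF finite_N closed] by (simp add: s)
  hence "clique Q" using diamond_edge_count_nonclique[OF Q(1)] degree_missing_le degree by fastforce
  ultimately show ?thesis using that closed by blast
qed

lemma iso_K1_join_K4_K1: "graph_iso 6 E K1_join_K4_K1"
proof -
  obtain Q s where N_v_eq: "N v = insert s Q" and Q: "s \<notin> Q" "clique Q" "closed_in (N v) Q"
    using neighbourhood_K4_K1 .
  hence s_nbr: "s \<in> N v" and Q_subset: "Q \<subseteq> N v" by auto
  show ?thesis
  proof (rule graph_iso_K1_join_K4_K1)
    show "v < 6" "s < 6" "v \<noteq> s" using v_less s_nbr adj_less by auto
    fix i j :: nat assume ij: "i < 6" "j < 6"
    consider "i = v \<or> j = v" | "i \<in> Q" "j \<in> Q" | "i = s" "j = s" | "i = s" "j \<in> Q" | "i \<in> Q" "j = s"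
    proof -
      have "i \<in> insert s Q" if "i < 6" "i \<noteq> v" for i
        using far_empty_adj[OF far_empty that] unfolding N_v_eq[symmetric] by simp
      thus ?thesis using that ij by blast
    qed
    thus "adj i j \<longleftrightarrow> i \<noteq> j \<and> (i = v \<or> j = v \<or> (i \<noteq> s \<and> j \<noteq> s))"
    proof cases
      case 1
      thus ?thesis using ij far_empty_adj[OF far_empty] adj_commute[of i j] by auto
    next
      case 2
      thus ?thesis using cliqueD[OF Q(2), of i j] Q(1) by (cases "i = j") auto
    next
      case 3 thus ?thesis using s_nbr by auto
    next
      case 4
      hence "\<not> adj i j" "j \<noteq> v"
        using closed_inD[OF Q(3), of j s] Q(1) s_nbr Q_subset by (auto simp: adj_commute)
      thus ?thesis using 4 s_nbr by auto
    next
      case 5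
      hence "\<not> adj i j" "i \<noteq> v" using closed_inD[OF Q(3), of i s] Q(1) s_nbr Q_subset by auto
      thus ?thesis using 5 s_nbr by auto
    qed
  qed
qed

end

lemma q_index_ge_imp_iso_K1_join_K4_K1:
  assumes "simple_graph 6 E" "no_isolated 6 E" "\<not> has_trebly_chorded_cycle_at_vertex E"
    and "q_index 6 K1_join_K4_K1 \<le> q_index 6 E"
  shows "graph_iso 6 E K1_join_K4_K1"
proof -
  interpret tcc_free 6 E using assms(1,3) by unfold_locales
  have "827 / 100 \<le> q_index 6 E" using assms(4) q_index_K1_join_K4_K1_ge by simp
  then obtain v y where "subsolution 6 E (827 / 100) 0 v y"
    using normalised_subsolution[OF assms(2), of 0 "827 / 100"] by auto
  then interpret order_6_subsolution E v y by (intro order_6_subsolution.intro tcc_free_axioms)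
  show ?thesis by (rule iso_K1_join_K4_K1)
qed

lemma q_index_ge_imp_iso_K112_plus:
  assumes "simple_graph n E" "no_isolated n E" "\<not> has_trebly_chorded_cycle_at_vertex E"
    and n: "7 \<le> n" and index: "q_index n (K112_plus n) \<le> q_index n E"
  shows "graph_iso n E (K112_plus n)"
proof -
  interpret tcc_free n E using assms(1,3) by unfold_locales
  obtain \<epsilon> :: real where eps: "0 \<le> \<epsilon>" "\<epsilon> \<le> 27 / 100" "\<epsilon> * (real n + 4) \<le> 4"
    "4 * real n - 16 \<le> \<epsilon> * (real n - \<epsilon>)\<^sup>2"
    using K112_plus_index_gap[OF n] .
  have "real n + 2 - \<epsilon> \<le> q_index n E"
    using index q_index_K112_plus_ge[OF n eps(1) _ eps(4)] eps(2) by simp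
  then obtain v y where "subsolution n E (real n + 2 - \<epsilon>) (1 / (real n + 4)) v y"
    using normalised_subsolution[OF assms(2), of "1 / (real n + 4)" "real n + 2 - \<epsilon>"] n by auto
  then interpret large_subsolution n E "real n + 2 - \<epsilon>" "1 / (real n + 4)" v y \<epsilon>
    using tcc_free_axioms n eps
    by (intro large_subsolution.intro large_subsolution_axioms.intro) auto
  show ?thesis by (rule iso_K112_plus)
qed

theorem theorem1p1:
  fixes n :: nat and E :: "nat set set"
  assumes "simple_graph n E" and "no_isolated n E" and "n \<ge> 6"
  shows "(n = 6 \<and> q_index n E \<ge> q_index 6 K1_join_K4_K1 \<and> \<not> graph_iso n E K1_join_K4_K1
            \<longrightarrow> has_trebly_chorded_cycle_at_vertex E)
       \<and> (n \<ge> 7 \<and> q_index n E \<ge> q_index n (K112_plus n) \<and> \<not> graph_iso n E (K112_plus n)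
            \<longrightarrow> has_trebly_chorded_cycle_at_vertex E)"
  using assms q_index_ge_imp_iso_K1_join_K4_K1[of E] q_index_ge_imp_iso_K112_plus[of n E] by blast

end
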